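(* For every integer $N\ge2$, the Ricci curvature of the Zeitlin metric on $SU(N)$ is strictly positive in the subspace $V_1$; that is, $\mathrm{Ric}(u,u)>0$ for every nonzero $u\in V_1$.
   Context: Let $\hbar_N=2/\sqrt{N^2-1}$. Let $S_1,S_2,S_3\in\mathfrak{su}(N)$ be the skew-Hermitian generators of the $N$-dimensional irreducible representation of $\mathfrak{so}(3)$, so $[S_1,S_2]=S_3$ and cyclically. Let $\mathcal{C}_i(u)=[S_i,u]$ on $\mathfrak{su}(N)$. The quantized Laplacian is $\Delta_N=\sum_{i=1}^3\mathcal{C}_i^2$. For $1\le\ell\le N-1$, $V_\ell\subset\mathfrak{su}(N)$ is the eigenspace of $\Delta_N$ with eigenvalue $-\ell(\ell+1)$ (of real dimension $2\ell+1$), and $\mathfrak{su}(N)=V_1\oplus\cdots\oplus V_{N-1}$. The Zeitlin metric is the right-invariant Riemannian metric on $SU(N)$ given on the Lie algebra by $\langle u,v\rangle=\frac1N\mathrm{Tr}(u^\dagger(-\Delta_N)v)$, where $\mathfrak{su}(N)$ carries the scaled bracket $\frac1{\hbar_N}[\cdot,\cdot]$ ($[\cdot,\cdot]$ the matrix commutator), with $\mathrm{ad}_uv=-\frac{1}{\hbar_N}[u,v]$. (Equivalently, $u\in\mathfrak{su}(N)$ is identified with the tangent vector at the identity whose matrix is $u/\hbar_N$, and the metric is right-invariant with value $\langle u,v\rangle$ on the tangent vectors corresponding to $u,v$.) $\mathrm{Ric}$ is the Ricci tensor (as a symmetric bilinear form) of this metric at the identity. *)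

theory Defs
  imports "HOL-Analysis.Analysis"
begin

section \<open>Levi-Civita connection and curvature of an embedded submanifold\<close>

text \<open>
  \<open>M\<close> is a submanifold of the normed space \<open>'a\<close>, \<open>T p\<close> is its tangent space at \<open>p\<close>, and
  \<open>m p\<close> is an inner product on \<open>T p\<close>. Sections over \<open>M\<close> are functions on all of \<open>'a\<close>, of which
  only the values on \<open>M\<close> matter. For \<open>p \<in> M\<close> the derivative within \<open>M\<close> is determined by the
  function only in directions tangent to \<open>M\<close>, and it is applied to such directions only.
  Vector fields are taken to be once differentiable: the Levi-Civita connection depends on the
  1-jet of its second argument, and at smooth fields it is the usual one.
\<close>

definition vector_field ::
    "'a::real_normed_vector set \<Rightarrow> ('a \<Rightarrow> 'a set) \<Rightarrow> ('a \<Rightarrow> 'a) \<Rightarrow> bool" where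
  "vector_field M T X \<longleftrightarrow> X differentiable_on M \<and> (\<forall>p\<in>M. X p \<in> T p)"

definition lie_bracket ::
    "'a::real_normed_vector set \<Rightarrow> ('a \<Rightarrow> 'a) \<Rightarrow> ('a \<Rightarrow> 'a) \<Rightarrow> 'a \<Rightarrow> 'a" where
  "lie_bracket M X Y p =
     frechet_derivative Y (at p within M) (X p) - frechet_derivative X (at p within M) (Y p)"

definition affine_connection ::
    "'a::real_normed_vector set \<Rightarrow> ('a \<Rightarrow> 'a set) \<Rightarrow>
     (('a \<Rightarrow> 'a) \<Rightarrow> ('a \<Rightarrow> 'a) \<Rightarrow> 'a \<Rightarrow> 'a) \<Rightarrow> bool" where
  "affine_connection M T D \<longleftrightarrow>
     (\<forall>X Y. vector_field M T X \<longrightarrow> vector_field M T Y \<longrightarrow> (\<forall>p\<in>M. D X Y p \<in> T p)) \<and>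
     (\<forall>X X' Y. vector_field M T X \<longrightarrow> vector_field M T X' \<longrightarrow> vector_field M T Y \<longrightarrow>
        (\<forall>p\<in>M. D (\<lambda>q. X q + X' q) Y p = D X Y p + D X' Y p)) \<and>
     (\<forall>(f::'a \<Rightarrow> real) X Y. f differentiable_on M \<longrightarrow> vector_field M T X \<longrightarrow> vector_field M T Y \<longrightarrow>
        (\<forall>p\<in>M. D (\<lambda>q. f q *\<^sub>R X q) Y p = f p *\<^sub>R D X Y p)) \<and>
     (\<forall>X Y Y'. vector_field M T X \<longrightarrow> vector_field M T Y \<longrightarrow> vector_field M T Y' \<longrightarrow>
        (\<forall>p\<in>M. D X (\<lambda>q. Y q + Y' q) p = D X Y p + D X Y' p)) \<and>
     (\<forall>(f::'a \<Rightarrow> real) X Y. f differentiable_on M \<longrightarrow> vector_field M T X \<longrightarrow> vector_field M T Y \<longrightarrow>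
        (\<forall>p\<in>M. D X (\<lambda>q. f q *\<^sub>R Y q) p =
           frechet_derivative f (at p within M) (X p) *\<^sub>R Y p + f p *\<^sub>R D X Y p))"

definition is_levi_civita ::
    "'a::real_normed_vector set \<Rightarrow> ('a \<Rightarrow> 'a set) \<Rightarrow> ('a \<Rightarrow> 'a \<Rightarrow> 'a \<Rightarrow> real) \<Rightarrow>
     (('a \<Rightarrow> 'a) \<Rightarrow> ('a \<Rightarrow> 'a) \<Rightarrow> 'a \<Rightarrow> 'a) \<Rightarrow> bool" where
  "is_levi_civita M T m D \<longleftrightarrow>
     affine_connection M T D \<and>
     (\<forall>X Y. vector_field M T X \<longrightarrow> vector_field M T Y \<longrightarrow>
        (\<forall>p\<in>M. D X Y p - D Y X p = lie_bracket M X Y p)) \<and>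
     (\<forall>X Y Z. vector_field M T X \<longrightarrow> vector_field M T Y \<longrightarrow> vector_field M T Z \<longrightarrow>
        (\<forall>p\<in>M. frechet_derivative (\<lambda>q. m q (Y q) (Z q)) (at p within M) (X p) =
           m p (D X Y p) (Z p) + m p (Y p) (D X Z p)))"

text \<open>
  The connection is unique on vector fields and points of \<open>M\<close>, so the choice is immaterial.
\<close>

definition levi_civita ::
    "'a::real_normed_vector set \<Rightarrow> ('a \<Rightarrow> 'a set) \<Rightarrow> ('a \<Rightarrow> 'a \<Rightarrow> 'a \<Rightarrow> real) \<Rightarrow>
     ('a \<Rightarrow> 'a) \<Rightarrow> ('a \<Rightarrow> 'a) \<Rightarrow> 'a \<Rightarrow> 'a" where
  "levi_civita M T m = (SOME D. is_levi_civita M T m D)"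

definition riemann_curvature ::
    "'a::real_normed_vector set \<Rightarrow> ('a \<Rightarrow> 'a set) \<Rightarrow> ('a \<Rightarrow> 'a \<Rightarrow> 'a \<Rightarrow> real) \<Rightarrow>
     ('a \<Rightarrow> 'a) \<Rightarrow> ('a \<Rightarrow> 'a) \<Rightarrow> ('a \<Rightarrow> 'a) \<Rightarrow> 'a \<Rightarrow> 'a" where
  "riemann_curvature M T m X Y Z p =
     (let D = levi_civita M T m
      in D X (D Y Z) p - D Y (D X Z) p - D (lie_bracket M X Y) Z p)"

definition trace_on :: "'a::real_vector set \<Rightarrow> ('a \<Rightarrow> 'a) \<Rightarrow> real" where
  "trace_on V f =
     (let B = (SOME B. independent B \<and> span B = V) in \<Sum>b\<in>B. representation B (f b) b)"

text \<open>
  \<open>Ric(y, z)\<close> is the trace of \<open>x \<mapsto> R(x, y) z\<close> on \<open>T p\<close>. Since curvature is tensorial, it may be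
  evaluated on any smooth extensions of the tangent vectors to vector fields; \<open>ext\<close> provides
  such extensions.
\<close>

definition ricci ::
    "'a::real_normed_vector set \<Rightarrow> ('a \<Rightarrow> 'a set) \<Rightarrow> ('a \<Rightarrow> 'a \<Rightarrow> 'a \<Rightarrow> real) \<Rightarrow>
     ('a \<Rightarrow> 'a \<Rightarrow> 'a) \<Rightarrow> 'a \<Rightarrow> 'a \<Rightarrow> 'a \<Rightarrow> real" where
  "ricci M T m ext p y z =
     trace_on (T p) (\<lambda>x. riemann_curvature M T m (ext x) (ext y) (ext z) p)"


section \<open>The special unitary group\<close>

definition dagger :: "complex^'n^'m \<Rightarrow> complex^'m^'n" where
  "dagger A = (\<chi> i j. cnj (A $ j $ i))"

definition commutator :: "complex^'n^'n \<Rightarrow> complex^'n^'n \<Rightarrow> complex^'n^'n" where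
  "commutator A B = A ** B - B ** A"

definition SU :: "(complex^'n^'n) set" where
  "SU = {g. dagger g ** g = mat 1 \<and> det g = 1}"

definition su :: "(complex^'n^'n) set" where
  "su = {u. dagger u = - u \<and> trace u = 0}"

definition SU_tangent :: "complex^'n^'n \<Rightarrow> (complex^'n^'n) set" where
  "SU_tangent g = {u ** g | u. u \<in> su}"

definition right_invariant_field :: "complex^'n^'n \<Rightarrow> complex^'n^'n \<Rightarrow> complex^'n^'n" where
  "right_invariant_field \<xi> = (\<lambda>g. \<xi> ** g)"


section \<open>The Zeitlin metric\<close>

definition so3_irrep ::
    "complex^'n^'n \<Rightarrow> complex^'n^'n \<Rightarrow> complex^'n^'n \<Rightarrow> bool" where
  "so3_irrep S1 S2 S3 \<longleftrightarrow>
     S1 \<in> su \<and> S2 \<in> su \<and> S3 \<in> su \<and>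
     commutator S1 S2 = S3 \<and> commutator S2 S3 = S1 \<and> commutator S3 S1 = S2 \<and>
     (\<forall>W. vec.subspace W \<longrightarrow>
        (\<forall>w\<in>W. S1 *v w \<in> W \<and> S2 *v w \<in> W \<and> S3 *v w \<in> W) \<longrightarrow> W = {0} \<or> W = UNIV)"

definition laplacian ::
    "complex^'n^'n \<Rightarrow> complex^'n^'n \<Rightarrow> complex^'n^'n \<Rightarrow> complex^'n^'n \<Rightarrow> complex^'n^'n" where
  "laplacian S1 S2 S3 u =
     commutator S1 (commutator S1 u) + commutator S2 (commutator S2 u) +
     commutator S3 (commutator S3 u)"

definition eigenspace_V ::
    "complex^'n^'n \<Rightarrow> complex^'n^'n \<Rightarrow> complex^'n^'n \<Rightarrow> nat \<Rightarrow> (complex^'n^'n) set" where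
  "eigenspace_V S1 S2 S3 l =
     {u \<in> su. laplacian S1 S2 S3 u = (- (real l * (real l + 1))) *\<^sub>R u}"

definition hbar :: "'n::finite itself \<Rightarrow> real" where
  "hbar _ = 2 / sqrt ((real CARD('n))\<^sup>2 - 1)"

text \<open>The trace below is real for \<open>u\<close> and \<open>v\<close> in \<open>su\<close>.\<close>

definition zeitlin_inner ::
    "complex^'n^'n \<Rightarrow> complex^'n^'n \<Rightarrow> complex^'n^'n \<Rightarrow> complex^'n^'n \<Rightarrow> complex^'n^'n \<Rightarrow> real" where
  "zeitlin_inner S1 S2 S3 u v =
     Re (trace (dagger u ** (- laplacian S1 S2 S3 v))) / real CARD('n)"

text \<open>
  An element \<open>u\<close> of the Lie algebra, with bracket scaled by \<open>1/hbar\<close>, corresponds to the tangent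
  matrix \<open>u/hbar\<close> at the identity, hence to \<open>(u/hbar) ** g\<close> at \<open>g\<close> by right translation. The metric
  inverts this identification, with \<open>dagger g\<close> the inverse of \<open>g\<close>.
\<close>

definition zeitlin_metric ::
    "complex^'n^'n \<Rightarrow> complex^'n^'n \<Rightarrow> complex^'n^'n \<Rightarrow>
     complex^'n^'n \<Rightarrow> complex^'n^'n \<Rightarrow> complex^'n^'n \<Rightarrow> real" where
  "zeitlin_metric S1 S2 S3 g X Y =
     zeitlin_inner S1 S2 S3 (hbar TYPE('n) *\<^sub>R (X ** dagger g)) (hbar TYPE('n) *\<^sub>R (Y ** dagger g))"

definition zeitlin_ricci ::
    "complex^'n^'n \<Rightarrow> complex^'n^'n \<Rightarrow> complex^'n^'n \<Rightarrow> complex^'n^'n \<Rightarrow> complex^'n^'n \<Rightarrow> real" where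
  "zeitlin_ricci S1 S2 S3 u v =
     ricci SU SU_tangent (zeitlin_metric S1 S2 S3) right_invariant_field (mat 1)
       ((1 / hbar TYPE('n)) *\<^sub>R u) ((1 / hbar TYPE('n)) *\<^sub>R v)"

end

theory Submission
  imports Defs
begin

text \<open>
  Write the metric on \<open>su\<close> as \<open>(x, y) \<mapsto> x \<bullet> T y\<close>, where \<open>\<bullet>\<close> is the real Hilbert-Schmidt product and
  \<open>T\<close> is a positive multiple of the negated Laplacian; \<open>T\<close> is the inertia operator in Arnold's
  picture of Euler equations. The theorem is an instance of Milnor's observation on invariant
  metrics: if \<open>ad u\<close> is skew for the inner product, then \<open>Ric u u\<close> is a sum of squares. Indeed, with
  \<open>A y = T\<^sup>-\<^sup>1 [T u, y]\<close>, the curvature is \<open>R y u u = - A (A y) / 4\<close>, and \<open>A\<close> is skew for the metric, so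
  that \<open>Ric u u\<close> is a quarter of the sum of \<open>\<parallel>A e\<parallel>\<^sup>2\<close> over an orthonormal basis
  (\<open>ricci_positive_symmetric_direction\<close>). It vanishes only if \<open>T u\<close> is central. For \<open>u\<close> in the first
  eigenspace \<open>T u\<close> is a positive multiple of \<open>u\<close>, and a central \<open>u\<close> is \<open>0\<close> by Schur's lemma.

  The hypothesis on \<open>ad u\<close> says that the metric is invariant under rotations about \<open>u\<close>. It holds
  because the eigenspace for \<open>-2\<close> is spanned by the generators, whose \<open>ad\<close> commutes with the
  Laplacian (\<open>eigenspace_V_1\<close>). That the eigenvalue \<open>-2\<close> has no further eigenvectors is the
  projection theorem for vector operators on an irreducible representation: if the trace-orthogonal
  complement of the generators inside the eigenspace were not \<open>0\<close>, it would contain a highest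
  weight vector, hence a triple \<open>X\<close> transforming as a vector. Schur's lemma makes the scalar \<open>S \<cdot> X\<close> vanish,
  and the identity \<open>X = S \<times> X\<close> then forces \<open>X = 0\<close>.

  Two facts link this algebra to the geometry. The derivative along \<open>SU\<close> of a function is well
  defined in tangent directions, because each tangent direction is a combination of velocities of
  explicit curves in \<open>SU\<close> (\<open>SU_derivative_unique\<close>). And the Levi-Civita connection exists and, on
  right-invariant fields, is given by the bilinear form of Arnold's formula (\<open>connection_levi_civita\<close>,
  \<open>levi_civita_invariant\<close>).
\<close>

section \<open>Complex matrices as a real inner product space\<close>

lemma mmul_rdistrib: "(B + C) ** A = B ** A + C ** (A::complex^'n^'n)"
  by (simp add: vec_eq_iff matrix_matrix_mult_def sum.distrib distrib_right)

lemma mmul_uminus_left [simp]: "(- A) ** B = - (A ** (B::complex^'n^'n))"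
  by (simp add: vec_eq_iff matrix_matrix_mult_def sum_negf)

lemma mmul_uminus_right [simp]: "A ** (- B) = - (A ** (B::complex^'n^'n))"
  by (simp add: vec_eq_iff matrix_matrix_mult_def sum_negf)

lemma mmul_diff_left: "(B - C) ** A = B ** A - C ** (A::complex^'n^'n)"
  using mmul_rdistrib[of B "- C" A] by simp

lemma mmul_diff_right: "A ** (B - C) = A ** B - A ** (C::complex^'n^'n)"
  using matrix_add_ldistrib[of A B "- C"] by simp

lemma mmul_scaleR_left [simp]: "(c *\<^sub>R A) ** B = c *\<^sub>R (A ** (B::complex^'n^'n))"
  by (simp add: vec_eq_iff matrix_matrix_mult_def scaleR_sum_right)

lemma mmul_scaleR_right [simp]: "A ** (c *\<^sub>R B) = c *\<^sub>R (A ** (B::complex^'n^'n))"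
  by (simp add: vec_eq_iff matrix_matrix_mult_def scaleR_sum_right)

lemma mmul_zero_left [simp]: "0 ** (A::complex^'n^'n) = 0"
  by (simp add: vec_eq_iff matrix_matrix_mult_def)

lemma mmul_zero_right [simp]: "(A::complex^'n^'n) ** 0 = 0"
  by (simp add: vec_eq_iff matrix_matrix_mult_def)

lemmas mmul_expand = matrix_add_ldistrib mmul_rdistrib mmul_diff_left mmul_diff_right matrix_mul_assoc

lemma bounded_bilinear_mmul:
  "bounded_bilinear ((**) :: complex^'n^'n \<Rightarrow> complex^'n^'n \<Rightarrow> complex^'n^'n)"
  by (intro bilinear_conv_bounded_bilinear[THEN iffD1])
     (simp add: bilinear_def linear_iff mmul_expand)

lemmas has_derivative_mmul [derivative_intros] = bounded_bilinear.FDERIV[OF bounded_bilinear_mmul]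

lemma dagger_simps [simp]:
  fixes A B :: "complex^'n^'n"
  shows "dagger (A + B) = dagger A + dagger B" "dagger (A - B) = dagger A - dagger B"
    "dagger (- A) = - dagger A" "dagger (c *\<^sub>R A) = c *\<^sub>R dagger A" "dagger 0 = (0::complex^'n^'n)"
    "dagger (dagger A) = A" "dagger (A ** B) = dagger B ** dagger A" 
    "dagger (mat z) = (mat (cnj z) :: complex^'n^'n)"
  by (simp_all add: vec_eq_iff dagger_def matrix_matrix_mult_def mat_def mult.commute)

lemma bounded_linear_dagger: "bounded_linear (dagger :: complex^'n^'n \<Rightarrow> complex^'n^'n)"
  by (intro linear_conv_bounded_linear[THEN iffD1]) (simp add: linear_iff)

lemmas has_derivative_dagger [derivative_intros] = bounded_linear.has_derivative[OF bounded_linear_dagger]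

lemma trace_simps [simp]:
  fixes A B :: "complex^'n^'n"
  shows "trace (A + B) = trace A + trace B" "trace (A - B) = trace A - trace B"
    "trace (- A) = - trace A" "trace (c *\<^sub>R A) = c *\<^sub>R trace A" "trace (0::complex^'n^'n) = 0"
  by (simp_all add: trace_def sum.distrib sum_subtractf sum_negf scaleR_sum_right)

lemma trace_mmul_commute: "trace (A ** B) = trace (B ** (A::complex^'n^'n))"
  using trace_mul_sym[of A B] by simp

lemma trace_dagger: "trace (dagger A) = cnj (trace (A::complex^'n^'n))"
  by (simp add: trace_def dagger_def)

lemma inner_matrix_trace: "A \<bullet> B = Re (trace (dagger A ** (B::complex^'n^'n)))"
proof -
  have "A \<bullet> B = (\<Sum>i\<in>UNIV. \<Sum>j\<in>UNIV. Re (cnj (A$i$j) * B$i$j))"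
    by (simp add: inner_vec_def inner_complex_def)
  also have "\<dots> = (\<Sum>j\<in>UNIV. \<Sum>i\<in>UNIV. Re (cnj (A$i$j) * B$i$j))"
    by (rule sum.swap)
  finally show ?thesis
    by (simp add: trace_def matrix_matrix_mult_def dagger_def)
qed

lemma inner_mmul_left:
  fixes A B S :: "complex^'n^'n"
  shows "(S ** A) \<bullet> B = A \<bullet> (dagger S ** (B::complex^'n^'n))"
  by (simp add: inner_matrix_trace matrix_mul_assoc)

lemma inner_mmul_right:
  fixes A B S :: "complex^'n^'n"
  shows "(A ** S) \<bullet> B = A \<bullet> (B ** dagger (S::complex^'n^'n))"
  by (simp add: inner_matrix_trace matrix_mul_assoc trace_mmul_commute[of "dagger A ** B"])

lemma mat_central: "mat z ** A = A ** (mat z :: complex^'n^'n)"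
proof -
  have *: "(\<Sum>k\<in>UNIV. (if i = k then z else 0) * A $ k $ j) = z * A $ i $ j"
     "(\<Sum>k\<in>UNIV. A $ i $ k * (if k = j then z else 0)) = z * A $ i $ j" for i j
    by (simp_all add: mult_delta_left mult_delta_right)
  show ?thesis by (simp add: vec_eq_iff matrix_matrix_mult_def mat_def *)
qed

lemma mat_mult_mat: "mat z ** mat w = (mat (z * w) :: complex^'n^'n)"
proof -
  have "(\<Sum>k\<in>UNIV. (if i = k then z else 0) * (if k = j then w else 0)) = (if i = j then z * w else 0)" for i j :: 'n
    by (simp add: mult_delta_left)
  then show ?thesis by (simp add: vec_eq_iff matrix_matrix_mult_def mat_def)
qed

lemma mat_uminus: "mat (- z) = - (mat z :: complex^'n^'n)"
  by (simp add: vec_eq_iff mat_def)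

lemma i_mmul_i: "mat \<i> ** (mat \<i> ** A) = - (A :: complex^'n^'n)"
  by (simp add: matrix_mul_assoc mat_mult_mat mat_uminus)

lemma commutator_simps:
  fixes A B C :: "complex^'n^'n"
  shows "commutator (A + B) C = commutator A C + commutator B C"
    "commutator C (A + B) = commutator C A + commutator C B"
    "commutator (A - B) C = commutator A C - commutator B C"
    "commutator C (A - B) = commutator C A - commutator C B"
    "commutator (- A) C = - commutator A C"
    "commutator C (- A) = - commutator C A"
    "commutator (c *\<^sub>R A) C = c *\<^sub>R commutator A C"
    "commutator C (c *\<^sub>R A) = c *\<^sub>R commutator C A"
    "commutator 0 C = 0" "commutator C 0 = 0" "commutator C C = 0"
  by (simp_all add: commutator_def mmul_expand scaleR_diff_right)

lemma commutator_swap: "commutator A B = - commutator B (A :: complex^'n^'n)"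
  by (simp add: commutator_def)

lemma commutator_jacobi:
  "commutator A (commutator B C) = commutator (commutator A B) C + commutator B (commutator A (C::complex^'n^'n))"
  by (simp add: commutator_def mmul_expand)

lemma commutator_i: "commutator A (mat \<i> ** B) = mat \<i> ** commutator A (B :: complex^'n^'n)"
  by (simp add: commutator_def mmul_diff_right matrix_mul_assoc mat_central[of \<i> A])

lemma trace_commutator [simp]:
  fixes A B :: "complex^'n^'n"
  shows "trace (commutator A B) = (0 :: complex)"
  by (simp add: commutator_def trace_mmul_commute[of A B])

lemma inner_commutator:
  fixes A B C :: "complex^'n^'n"
  shows "commutator A B \<bullet> C = B \<bullet> commutator (dagger A) (C :: complex^'n^'n)"
  by (simp add: commutator_def inner_diff_left inner_diff_right
      inner_mmul_left[where S=A] inner_mmul_right[where S=A])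

lemma subspace_su: "subspace su"
  by (auto simp: subspace_def su_def)

lemma su_dagger: "u \<in> su \<Longrightarrow> dagger u = - u" by (simp add: su_def)

lemma commutator_su: "u \<in> su \<Longrightarrow> v \<in> su \<Longrightarrow> commutator u v \<in> su"
  by (auto simp: su_def) (simp add: commutator_def)

lemma inner_commutator_su:
  "u \<in> su \<Longrightarrow> commutator u B \<bullet> C = - (B \<bullet> commutator u C)"
  by (simp add: inner_commutator su_dagger commutator_simps)

lemma inner_i: "(mat \<i> ** A) \<bullet> B = - (A \<bullet> (mat \<i> ** (B :: complex^'n^'n)))"
  by (simp add: inner_mmul_left mat_uminus)

section \<open>Derivatives along the special unitary group\<close>

text \<open>
  From \<open>u\<^sup>3 = - u\<close> the exponential of \<open>t u\<close> is \<open>1 + sin t u + (1 - cos t) u\<^sup>2\<close>. Its determinant is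
  controlled without differentiating: conjugation by \<open>h\<close> turns \<open>U t\<close> into its inverse \<open>U (- t)\<close>, so
  the determinant is \<open>1\<close> or \<open>-1\<close>, and the square of \<open>U (t / 2)\<close> has determinant \<open>1\<close>.
\<close>
lemma rotation_curve_in_SU:
  fixes u h p :: "complex^'n^'n"
  assumes skew: "dagger u = - u" and cube: "u ** u ** u = - u"
    and hh: "h ** h = mat 1" and hu: "h ** u = - (u ** h)" and p: "p \<in> SU"
  obtains \<gamma> :: "real \<Rightarrow> complex^'n^'n" where "\<gamma> 0 = p" "\<And>t. \<gamma> t \<in> SU"
    "(\<gamma> has_derivative (\<lambda>s. s *\<^sub>R (u ** p))) (at 0)"
proof -
  define U where "U t = mat 1 + sin t *\<^sub>R u + (1 - cos t) *\<^sub>R (u ** u)" for t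
  have U0: "U 0 = mat 1" by (simp add: U_def)
  have dU: "dagger (U t) = U (- t)" for t by (simp add: U_def skew)
  have fourth: "u ** u ** u ** u = - (u ** u)" by (simp add: cube)
  have pythagoras: "(cos t * cos t) *\<^sub>R A + (sin t * sin t) *\<^sub>R A = A" for t and A :: "complex^'n^'n"
    by (simp flip: scaleR_add_left)
  have UU: "U t ** U (- t) = mat 1" for t
    by (simp add: U_def mmul_expand cube fourth algebra_simps pythagoras)
  have UmU: "U (- t) ** U t = mat 1" for t using UU[of "- t"] by simp
  have uhu: "u ** h ** u = - (u ** u ** h)"
    using hu by (simp flip: matrix_mul_assoc)
  have "h ** U t = U (- t) ** h" for t
    by (simp add: U_def mmul_expand hu uhu)
  then have "h ** U t ** h = U (- t)" for t
    by (simp add: hh flip: matrix_mul_assoc)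
  then have "det (U (- t)) = det h * det (U t) * det h" for t
    by (simp flip: det_mul)
  moreover have "det h * det h = 1"
    using hh by (metis det_I det_mul)
  ultimately have det_eq: "det (U (- t)) = det (U t)" for t
    by (simp add: mult.assoc mult.left_commute[of "det h" "det (U _)"])
  have det1: "det (U t) * det (U t) = 1" for t
    using det_mul[of "U t" "U (- t)"] by (simp add: UU det_eq)
  define V where "V t = U (t / 2)" for t
  have V0: "V 0 = mat 1" and dV: "dagger (V t) = U (- (t / 2))" and detV: "det (V t) * det (V t) = 1" for t
    by (simp_all add: V_def U0 dU det1)
  define \<gamma> where "\<gamma> t = V t ** V t ** p" for t
  have pp: "dagger p ** p = mat 1" "det p = 1" using p by (auto simp: SU_def)
  have "dagger (\<gamma> t) ** \<gamma> t = dagger p ** (U (- (t / 2)) ** (U (- (t / 2)) ** V t) ** V t) ** p" for t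
    by (simp add: \<gamma>_def dV matrix_mul_assoc)
  then have "dagger (\<gamma> t) ** \<gamma> t = mat 1" for t
    by (simp add: V_def UmU pp)
  moreover have "det (\<gamma> t) = 1" for t by (simp add: \<gamma>_def det_mul detV pp)
  ultimately have "\<gamma> t \<in> SU" for t by (simp add: SU_def)
  moreover have "\<gamma> 0 = p" by (simp add: \<gamma>_def V0)
  moreover have "(V has_derivative (\<lambda>s. (s / 2) *\<^sub>R u)) (at 0)"
    unfolding V_def U_def by (auto intro!: derivative_eq_intros)
  then have "((\<lambda>t. V t ** V t ** p) has_derivative
      (\<lambda>s. (V 0 ** ((s / 2) *\<^sub>R u) + ((s / 2) *\<^sub>R u) ** V 0) ** p)) (at 0)"
    by (auto intro!: derivative_eq_intros)
  then have "(\<gamma> has_derivative (\<lambda>s. s *\<^sub>R (u ** p))) (at 0)"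
    unfolding \<gamma>_def V0 by (simp add: mmul_rdistrib flip: scaleR_add_left)
  ultimately show ?thesis using that by blast
qed

definition outer :: "complex^'n \<Rightarrow> complex^'n \<Rightarrow> complex^'n^'n" where
  "outer z w = (\<chi> i j. z $ i * cnj (w $ j))"

definition hermitian_product :: "complex^'n \<Rightarrow> complex^'n \<Rightarrow> complex" where
  "hermitian_product w z = (\<Sum>i\<in>UNIV. cnj (w $ i) * z $ i)"

lemma dagger_outer: "dagger (outer z w) = outer w z"
  by (simp add: vec_eq_iff dagger_def outer_def)

lemma outer_mmul_outer:
  "outer z w ** outer x y = mat (hermitian_product w x) ** outer z y"
proof -
  have "(\<Sum>k\<in>UNIV. z $ i * cnj (w $ k) * (x $ k * cnj (y $ j)))
     = hermitian_product w x * (z $ i * cnj (y $ j))" for i j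
    by (simp add: hermitian_product_def sum_distrib_left sum_distrib_right mult_ac)
  then show ?thesis
    by (simp add: vec_eq_iff matrix_matrix_mult_def mat_def outer_def mult_delta_left)
qed

text \<open>Infinitesimal rotations in the plane spanned by two orthonormal vectors.\<close>
definition plane_rotations :: "(complex^'n^'n) set" where
  "plane_rotations = {outer z w - outer w z | z w.
     hermitian_product z z = 1 \<and> hermitian_product w w = 1 \<and> hermitian_product z w = 0}"

lemma hermitian_product_cnj: "hermitian_product z w = cnj (hermitian_product w z)"
  by (simp add: hermitian_product_def mult.commute)

lemma plane_rotation_curve:
  fixes u p :: "complex^'n^'n"
  assumes u: "u \<in> plane_rotations" and p: "p \<in> SU"
  obtains \<gamma> :: "real \<Rightarrow> complex^'n^'n" where "\<gamma> 0 = p" "\<And>t. \<gamma> t \<in> SU"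
    "(\<gamma> has_derivative (\<lambda>s. s *\<^sub>R (u ** p))) (at 0)"
proof -
  obtain z w where uzw: "u = outer z w - outer w z"
    and on: "hermitian_product z z = 1" "hermitian_product w w = 1" "hermitian_product z w = 0"
    using u by (auto simp: plane_rotations_def)
  have on': "hermitian_product w z = 0" using on(3) hermitian_product_cnj[of w z] by simp
  (* The reflection in the hyperplane orthogonal to z reverses the rotation. *)
  define h where "h = mat 1 - 2 *\<^sub>R outer z z"
  note rules = outer_mmul_outer on on' mmul_expand
  have hu: "h ** u = u - 2 *\<^sub>R outer z w" "u ** h = u + 2 *\<^sub>R outer w z"
    by (simp_all add: h_def uzw rules)
  have uu: "u ** u = - outer z z - outer w w" by (simp add: uzw rules)
  show ?thesis
  proof (rule rotation_curve_in_SU[of u h p])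
    show "dagger u = - u" by (simp add: uzw dagger_outer)
    show "u ** u ** u = - u" unfolding uu by (simp add: uzw rules)
    show "h ** h = mat 1" by (simp add: h_def rules) (simp add: scaleR_diff_right flip: scaleR_diff_left)
    show "h ** u = - (u ** h)" by (simp add: hu) (simp add: uzw scaleR_2)
  qed (use p that in auto)
qed

lemma hermitian_product_axis: "hermitian_product (axis j a) (axis k b) = (if j = k then cnj a * b else 0)"
proof -
  have "hermitian_product (axis j a) (axis k b) =
      (\<Sum>i\<in>UNIV. if i = k then (if j = k then cnj a * b else 0) else 0)"
    unfolding hermitian_product_def by (rule sum.cong) (auto simp: axis_def)
  then show ?thesis by simp
qed

lemma hermitian_product_add:
  "hermitian_product (x + y) z = hermitian_product x z + hermitian_product y z"
  "hermitian_product z (x + y) = hermitian_product z x + hermitian_product z y"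
  "hermitian_product z (- y) = - hermitian_product z y"
  by (simp_all add: hermitian_product_def sum.distrib algebra_simps sum_negf)

lemma off_diagonal_in_span:
  fixes j k :: "'n::finite"
  assumes "j \<noteq> k"
  shows "outer (axis j a) (axis k 1) - outer (axis k 1) (axis j a) \<in> span plane_rotations"
proof (cases "a = 0")
  case True
  then have "axis j a = 0" by (simp add: axis_def vec_eq_iff)
  then show ?thesis by (simp add: outer_def vec_eq_iff span_0 zero_vec_def[symmetric])
next
  case False
  define b where "b = a / of_real (cmod a)"
  have ab: "cmod a *\<^sub>R b = a" "cmod a *\<^sub>R cnj b = cnj a"
    using False by (simp_all add: b_def scaleR_conv_of_real)
  have "cnj b * b = 1"
    using False complex_norm_square[of a] by (simp add: b_def power2_eq_square mult.commute)
  then have "outer (axis j b) (axis k 1) - outer (axis k 1) (axis j b) \<in> plane_rotations"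
    using assms unfolding plane_rotations_def
    by (intro CollectI exI[of _ "axis j b"] exI[of _ "axis k 1"]) (simp add: hermitian_product_axis)
  then have "cmod a *\<^sub>R (outer (axis j b) (axis k 1) - outer (axis k 1) (axis j b)) \<in> span plane_rotations"
    by (intro span_scale span_base)
  moreover have "cmod a *\<^sub>R (outer (axis j b) (axis k 1) - outer (axis k 1) (axis j b))
     = outer (axis j a) (axis k 1) - outer (axis k 1) (axis j a)"
    using assms by (auto simp: vec_eq_iff outer_def axis_def ab)
  ultimately show ?thesis by simp
qed

text \<open>
  The plane of the two axes contains the orthonormal vectors \<open>(e j + e k) / sqrt 2\<close> and
  \<open>\<i> (e j - e k) / sqrt 2\<close>, whose rotation generator is diagonal.
\<close>
lemma diagonal_in_span:
  fixes j k :: "'n::finite"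
  shows "outer (axis j \<i>) (axis j 1) - outer (axis k \<i>) (axis k 1) \<in> span plane_rotations"
proof (cases "j = k")
  case False
  define r where "r = complex_of_real (1 / sqrt 2)"
  have rr: "cnj r = r" by (simp add: r_def)
  have rr2: "r * r = 1 / 2"
    by (simp add: r_def flip: of_real_mult)
  let ?z = "axis j (\<i> * r) + axis k (- \<i> * r)" and ?w = "axis j r + axis k r"
  have "outer ?z ?w - outer ?w ?z \<in> plane_rotations"
    unfolding plane_rotations_def
    by (intro CollectI exI[of _ ?z] exI[of _ ?w])
      (use False in \<open>simp add: hermitian_product_axis hermitian_product_add rr rr2 algebra_simps\<close>)
  moreover have "outer ?z ?w - outer ?w ?z
      = outer (axis j \<i>) (axis j 1) - outer (axis k \<i>) (axis k 1)"
    using False by (auto simp: vec_eq_iff outer_def axis_def rr rr2 algebra_simps)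
  ultimately show ?thesis by (metis span_base)
qed (simp add: span_0)

lemma su_subset_span_plane_rotations: "su \<subseteq> span (plane_rotations :: (complex^'n^'n) set)"
proof
  fix u :: "complex^'n^'n"
  assume u: "u \<in> su"
  have skew: "cnj (u $ k $ j) = - u $ j $ k" for j k
    using su_dagger[OF u] by (simp add: vec_eq_iff dagger_def)
  (* A reference index: by tracelessness the diagonal is a combination of differences with it. *)
  obtain o' :: 'n where True by simp
  define E where "E j k = (if j = k then 0
      else outer (axis j (u $ j $ k)) (axis k 1) - outer (axis k 1) (axis j (u $ j $ k)))" for j k
  define D where "D j = outer (axis j \<i>) (axis j 1) - outer (axis o' \<i>) (axis o' 1)" for j :: 'n
  have diag: "u $ j $ j = \<i> * Im (u $ j $ j)" for j
    using skew[of j j] by (simp add: complex_eq_iff)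
  have tr: "(\<Sum>j\<in>UNIV. Im (u $ j $ j)) = 0"
    using u by (simp add: su_def trace_def flip: Im_sum)
  have decomposition: "u = (1/2) *\<^sub>R (\<Sum>j\<in>UNIV. \<Sum>k\<in>UNIV. E j k) + (\<Sum>j\<in>UNIV. Im (u $ j $ j) *\<^sub>R D j)"
  proof -
    have "E j k $ a $ b = (if k = b then if j = a then if a = b then 0 else u $ a $ b else 0 else 0)
         + (if k = a then if j = b then if a = b then 0 else u $ a $ b else 0 else 0)" for j k a b
      by (auto simp: E_def outer_def axis_def skew)
    then have "(\<Sum>j\<in>UNIV. \<Sum>k\<in>UNIV. E j k) $ a $ b = (if a = b then 0 else 2 * u $ a $ b)" for a b
      by (simp add: sum.distrib)
    moreover have "(\<Sum>j\<in>UNIV. Im (u $ j $ j) *\<^sub>R D j) $ a $ b = (if a = b then u $ a $ b else 0)" for a b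
    proof -
      have "(\<Sum>j\<in>UNIV. Im (u $ j $ j) *\<^sub>R D j) =
        (\<Sum>j\<in>UNIV. Im (u $ j $ j) *\<^sub>R outer (axis j \<i>) (axis j 1))
        - (\<Sum>j\<in>UNIV. Im (u $ j $ j)) *\<^sub>R outer (axis o' \<i>) (axis o' 1)"
        by (simp add: D_def scaleR_diff_right sum_subtractf scaleR_sum_left)
      also have "\<dots> $ a $ b = (\<Sum>j\<in>UNIV. Im (u $ j $ j) *\<^sub>R outer (axis j \<i>) (axis j 1) $ a $ b)"
        by (simp add: tr)
      also have "\<dots> = (\<Sum>j\<in>UNIV. if a = j then (if a = b then \<i> * Im (u $ a $ a) else 0) else 0)"
        by (rule sum.cong) (auto simp: outer_def axis_def scaleR_conv_of_real)
      finally show ?thesis using diag[of a, symmetric] by (cases "a = b") simp_all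
    qed
    ultimately show ?thesis by (simp add: vec_eq_iff del: sum_component)
  qed
  have "(\<Sum>j\<in>UNIV. \<Sum>k\<in>UNIV. E j k) \<in> span plane_rotations"
    unfolding E_def by (intro span_sum) (simp add: span_0 off_diagonal_in_span)
  moreover have "(\<Sum>j\<in>UNIV. Im (u $ j $ j) *\<^sub>R D j) \<in> span plane_rotations"
    unfolding D_def by (intro span_sum span_scale diagonal_in_span)
  ultimately show "u \<in> span plane_rotations"
    by (subst decomposition) (intro span_add span_scale)
qed

text \<open>
  As \<open>SU\<close> has empty interior, the derivative of a function within \<open>SU\<close> is not unique as a linear map
  on all matrices. Its values on velocities of curves in \<open>SU\<close>, hence on their span, are unique.
\<close>
lemma SU_derivative_unique:
  fixes f :: "complex^'n^'n \<Rightarrow> 'b::real_normed_vector"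
  assumes f1: "(f has_derivative f1) (at p within SU)" and f2: "(f has_derivative f2) (at p within SU)"
    and p: "p \<in> SU" and v: "v \<in> SU_tangent p"
  shows "f1 v = f2 v"
proof -
  have along: "f' (u ** p) = f'' (u ** p)"
    if u: "u \<in> plane_rotations" and f': "(f has_derivative f') (at p within SU)"
      and f'': "(f has_derivative f'') (at p within SU)" for u f' f''
  proof -
    obtain \<gamma> where \<gamma>: "\<gamma> 0 = p" "\<And>t. \<gamma> t \<in> SU"
      "(\<gamma> has_derivative (\<lambda>s. s *\<^sub>R (u ** p))) (at 0)"
      using plane_rotation_curve[OF u p] by blast
    have "((f \<circ> \<gamma>) has_derivative (f' \<circ> (\<lambda>s. s *\<^sub>R (u ** p)))) (at 0)" 
      if "(f has_derivative f') (at p within SU)" for f'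
      by (rule diff_chain_within[OF \<gamma>(3)])
        (use that \<gamma> in \<open>auto intro: has_derivative_subset\<close>)
    from has_derivative_unique[OF this[OF f'] this[OF f'']]
    have "(f' \<circ> (\<lambda>s. s *\<^sub>R (u ** p))) 1 = (f'' \<circ> (\<lambda>s. s *\<^sub>R (u ** p))) 1"
      by (rule fun_cong)
    then show ?thesis by simp
  qed
  have lin: "linear f1" "linear f2"
    using f1 f2 by (auto intro: has_derivative_linear)
  have linp: "linear (\<lambda>u. u ** p)" by (simp add: linear_iff mmul_expand)
  obtain u where vu: "v = u ** p" and u: "u \<in> su" using v by (auto simp: SU_tangent_def)
  have "(f1 \<circ> (\<lambda>u. u ** p)) u = (f2 \<circ> (\<lambda>u. u ** p)) u"
  proof (rule linear_eq_on_span[of _ _ plane_rotations])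
    show "u \<in> span plane_rotations" using u su_subset_span_plane_rotations by blast
    show "linear (f1 \<circ> (\<lambda>u. u ** p))" "linear (f2 \<circ> (\<lambda>u. u ** p))"
      using lin linp by (auto intro: linear_compose)
    show "(f1 \<circ> (\<lambda>u. u ** p)) x = (f2 \<circ> (\<lambda>u. u ** p)) x" if "x \<in> plane_rotations" for x
      using along[OF that f1 f2] lin by (simp add: linear_scale)
  qed
  then show ?thesis by (simp add: vu)
qed

section \<open>The first eigenspace of the quantized Laplacian\<close>

text \<open>
  The maximizer of the quadratic form on the unit sphere of \<open>W\<close>; the first variation in the
  direction of the residual \<open>T x - \<mu> x\<close> shows that the residual is \<open>0\<close>. The maximality of \<open>\<mu>\<close> is
  what produces highest weight vectors below.
\<close>
lemma symmetric_operator_top_eigenvector: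
  fixes T :: "'a::euclidean_space \<Rightarrow> 'a"
  assumes lin: "linear T" and W: "subspace W" and inv: "\<And>x. x \<in> W \<Longrightarrow> T x \<in> W"
    and sym: "\<And>x y. T x \<bullet> y = x \<bullet> T y" and nz: "w \<in> W" "w \<noteq> 0"
  obtains x \<mu> where "x \<in> W" "x \<noteq> 0" "T x = \<mu> *\<^sub>R x" "\<And>y. y \<in> W \<Longrightarrow> T y \<bullet> y \<le> \<mu> * (y \<bullet> y)"
proof -
  let ?S = "W \<inter> sphere 0 1"
  have "compact ?S" using W by (simp add: closed_subspace compact_Int_closed Int_commute[of W])
  moreover have "w /\<^sub>R norm w \<in> ?S" using nz W by (simp add: subspace_scale)
  moreover have "continuous_on ?S (\<lambda>x. T x \<bullet> x)"
    using lin by (intro continuous_intros linear_continuous_on) (simp add: linear_conv_bounded_linear)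
  ultimately obtain x where x: "x \<in> ?S" and max: "\<And>y. y \<in> ?S \<Longrightarrow> T y \<bullet> y \<le> T x \<bullet> x"
    using continuous_attains_sup[of ?S "\<lambda>x. T x \<bullet> x"] by blast
  define \<mu> where "\<mu> = T x \<bullet> x"
  have bound: "T y \<bullet> y \<le> \<mu> * (y \<bullet> y)" if "y \<in> W" for y
  proof (cases "y = 0")
    case True
    then show ?thesis using lin by (simp add: linear_0)
  next
    case False
    have "y /\<^sub>R norm y \<in> ?S" using that W False by (simp add: subspace_scale)
    from max[OF this] have "(T y \<bullet> y) / (norm y)\<^sup>2 \<le> \<mu>"
      using lin by (simp add: \<mu>_def linear_scale power2_eq_square field_simps)
    then show ?thesis using False by (simp add: power2_norm_eq_inner field_simps)
  qed
  define r where "r = T x - \<mu> *\<^sub>R x"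
  have xx: "x \<bullet> x = 1" using x by (simp add: norm_eq_1)
  have rW: "r \<in> W" using x inv W by (simp add: r_def subspace_diff subspace_scale)
  define q where "q = \<mu> * (r \<bullet> r) - T r \<bullet> r"
  have rr: "r \<bullet> r = T x \<bullet> r - \<mu> * (x \<bullet> r)"
  proof -
    have "r \<bullet> r = (T x - \<mu> *\<^sub>R x) \<bullet> r" by (simp only: r_def)
    then show ?thesis by (simp only: inner_diff_left inner_scaleR_left)
  qed
  have variation: "2 * t * (r \<bullet> r) \<le> t\<^sup>2 * q" for t
  proof -
    have "T (x + t *\<^sub>R r) \<bullet> (x + t *\<^sub>R r) \<le> \<mu> * ((x + t *\<^sub>R r) \<bullet> (x + t *\<^sub>R r))"
      using x rW W by (intro bound) (simp add: subspace_add subspace_scale)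
    moreover have "T (x + t *\<^sub>R r) \<bullet> (x + t *\<^sub>R r) = \<mu> + 2 * t * (T x \<bullet> r) + t\<^sup>2 * (T r \<bullet> r)"
      using lin sym[of r x]
      by (simp add: linear_add linear_scale inner_add_left inner_add_right \<mu>_def power2_eq_square
          algebra_simps inner_commute[of r "T x"])
    moreover have "(x + t *\<^sub>R r) \<bullet> (x + t *\<^sub>R r) = 1 + 2 * t * (x \<bullet> r) + t\<^sup>2 * (r \<bullet> r)"
      by (simp add: inner_add_left inner_add_right xx power2_eq_square algebra_simps inner_commute[of r x])
    ultimately have "\<mu> + 2 * t * (T x \<bullet> r) + t\<^sup>2 * (T r \<bullet> r)
        \<le> \<mu> * (1 + 2 * t * (x \<bullet> r) + t\<^sup>2 * (r \<bullet> r))" by simp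
    moreover have "2 * t * (r \<bullet> r) = 2 * t * (T x \<bullet> r) - \<mu> * (2 * t * (x \<bullet> r))"
      unfolding rr by (simp add: algebra_simps)
    ultimately show ?thesis by (simp add: q_def algebra_simps)
  qed
  have "r \<bullet> r = 0"
  proof (cases "q \<le> 0")
    case True
    moreover have "2 * (r \<bullet> r) \<le> q" using variation[of 1] by simp
    ultimately show ?thesis using inner_ge_zero[of r] by linarith
  next
    case False
    with variation[of "(r \<bullet> r) / q"] have "(r \<bullet> r) * (r \<bullet> r) \<le> 0"
      by (simp add: field_simps power2_eq_square del: inner_eq_zero_iff)
    then show ?thesis by (metis mult_le_0_iff inner_ge_zero order_antisym)
  qed
  then have "T x = \<mu> *\<^sub>R x" by (simp add: r_def)
  then show ?thesis using that x bound xx by force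
qed

lemma trace_mat: "trace (mat z :: complex^'n^'n) = of_nat CARD('n) * z"
  by (simp add: trace_def mat_def)

lemma inner_matrix_vector: "(A *v x) \<bullet> y = x \<bullet> (dagger A *v (y :: complex^'n))"
  for A :: "complex^'n^'n"
proof -
  have "(A *v x) \<bullet> y = Re (\<Sum>i\<in>UNIV. \<Sum>j\<in>UNIV. cnj (A $ i $ j) * cnj (x $ j) * y $ i)"
    by (simp add: inner_vec_def inner_complex_def matrix_vector_mult_def sum_distrib_right)
      (simp add: sum_subtractf sum.distrib sum_distrib_right algebra_simps)
  also have "\<dots> = Re (\<Sum>j\<in>UNIV. \<Sum>i\<in>UNIV. cnj (A $ i $ j) * cnj (x $ j) * y $ i)"
    by (subst sum.swap) simp
  also have "\<dots> = x \<bullet> (dagger A *v y)"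
    by (simp add: inner_vec_def inner_complex_def matrix_vector_mult_def dagger_def sum_distrib_left)
      (simp add: sum_subtractf sum.distrib sum_distrib_left algebra_simps)
  finally show ?thesis .
qed

lemma mat_mult_vector: "mat z *v w = z *s (w :: complex^'n)"
  by (simp add: vec_eq_iff matrix_vector_mult_def mat_def mult_delta_left)

lemma matrix_eq_mat:
  fixes A :: "complex^'n^'n"
  assumes "\<And>w. A *v w = z *s w"
  shows "A = mat z"
  using assms by (simp add: matrix_eq mat_mult_vector)

lemma commutator_eq_0_iff: "commutator A B = 0 \<longleftrightarrow> A ** B = B ** A"
  by (simp add: commutator_def)

lemma commutator_mmul: "commutator A (B ** C) = commutator A B ** C + B ** commutator A (C :: complex^'n^'n)"
  by (simp add: commutator_def mmul_expand)

locale so3_irreducible =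
  fixes S1 S2 S3 :: "complex^'n^'n"
  assumes irrep: "so3_irrep S1 S2 S3" and card: "CARD('n) \<ge> 2"
begin

lemma generators_su: "S1 \<in> su" "S2 \<in> su" "S3 \<in> su"
  and brackets: "commutator S1 S2 = S3" "commutator S2 S3 = S1" "commutator S3 S1 = S2"
    "commutator S2 S1 = - S3" "commutator S3 S2 = - S1" "commutator S1 S3 = - S2"
  using irrep commutator_swap[of S2 S1] commutator_swap[of S3 S2] commutator_swap[of S1 S3]
  unfolding so3_irrep_def by simp_all

lemma invariant_subspace:
  assumes "vec.subspace W" "\<And>w. w \<in> W \<Longrightarrow> S1 *v w \<in> W" "\<And>w. w \<in> W \<Longrightarrow> S2 *v w \<in> W" "\<And>w. w \<in> W \<Longrightarrow> S3 *v w \<in> W"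
  shows "W = {0} \<or> W = UNIV"
  using irrep assms unfolding so3_irrep_def by blast

text \<open>An eigenspace of \<open>A\<close> is invariant, hence everything.\<close>
lemma schur_hermitian:
  assumes herm: "dagger A = A" and comm: "commutator S1 A = 0" "commutator S2 A = 0" "commutator S3 A = 0"
  obtains \<mu> :: real where "A = mat (of_real \<mu>)"
proof -
  obtain x \<mu> where x: "x \<noteq> 0" and eig: "A *v x = \<mu> *\<^sub>R x"
  proof (rule symmetric_operator_top_eigenvector[of "(*v) A" UNIV "axis undefined 1"])
    show "linear ((*v) A)"
      by (rule matrix_vector_mul_linear)
    show "(A *v x) \<bullet> y = x \<bullet> (A *v y)" for x y by (simp add: inner_matrix_vector herm)
  qed (auto simp: axis_eq_0_iff)
  have eig': "A *v x = of_real \<mu> *s x"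
    unfolding eig by (simp add: vec_eq_iff scaleR_conv_of_real[where 'a=complex])
  let ?W = "{w. A *v w = of_real \<mu> *s w}"
  have inv: "S *v w \<in> ?W" if "commutator S A = 0" "w \<in> ?W" for S w
  proof -
    have "A *v (S *v w) = S *v (A *v w)"
      using that(1) by (simp add: commutator_eq_0_iff matrix_vector_mul_assoc)
    then show ?thesis using that(2) by (simp add: vector_scalar_commute)
  qed
  have "vec.subspace ?W"
    by (simp add: vec.subspace_def matrix_vector_right_distrib vector_scalar_commute vec.scale_right_distrib mult.commute)
  then have "?W = {0} \<or> ?W = UNIV"
    by (rule invariant_subspace) (rule inv; simp add: comm)+
  then have "?W = UNIV" using x eig' by blast
  then have "A = mat (of_real \<mu>)" by (intro matrix_eq_mat) blast
  then show ?thesis using that by blast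
qed

text \<open>Split \<open>Z\<close> into its two Hermitian parts.\<close>
lemma schur:
  assumes comm: "commutator S1 Z = 0" "commutator S2 Z = 0" "commutator S3 Z = 0"
  obtains z where "Z = mat z"
proof -
  have comm': "commutator S (dagger Z) = 0" if "commutator S Z = 0" "S \<in> su" for S
  proof -
    have "dagger (commutator S Z) = commutator S (dagger Z)"
      using su_dagger[OF that(2)] by (simp add: commutator_def)
    then show ?thesis using that by simp
  qed
  note rules = comm comm'[OF comm(1) generators_su(1)] comm'[OF comm(2) generators_su(2)]
    comm'[OF comm(3) generators_su(3)] commutator_simps commutator_i
  obtain a where a: "Z + dagger Z = mat a"
  proof (rule schur_hermitian)
    show "dagger (Z + dagger Z) = Z + dagger Z" by (simp add: add.commute)
  qed (simp_all add: rules)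
  obtain b where b: "mat \<i> ** (Z - dagger Z) = mat b"
  proof (rule schur_hermitian)
    show "dagger (mat \<i> ** (Z - dagger Z)) = mat \<i> ** (Z - dagger Z)"
      by (simp add: mat_uminus mmul_expand mat_central[of \<i>])
  qed (simp_all add: rules)
  have "mat \<i> ** (mat \<i> ** (Z - dagger Z)) = mat (\<i> * b)" by (simp add: b mat_mult_mat)
  then have "- (Z - dagger Z) = mat (\<i> * b)" unfolding i_mmul_i .
  from this[symmetric] have c: "Z - dagger Z = mat (- \<i> * b)" by (simp add: mat_uminus)
  have "2 *\<^sub>R Z = (Z + dagger Z) + (Z - dagger Z)" by (simp add: scaleR_2)
  then have "2 *\<^sub>R Z = mat a + mat (- \<i> * b)" unfolding a c .
  then have "(1/2) *\<^sub>R (2 *\<^sub>R Z) = (1/2) *\<^sub>R (mat a + mat (- \<i> * b))"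
    by (simp only:)
  then have "Z = (1/2) *\<^sub>R (mat a + mat (- \<i> * b))" by simp
  also have "\<dots> = mat ((a - \<i> * b) / 2)"
    by (simp add: vec_eq_iff mat_def scaleR_conv_of_real[where 'a=complex])
  finally show ?thesis using that by blast
qed

lemma schur_traceless:
  assumes "commutator S1 Z = 0" "commutator S2 Z = 0" "commutator S3 Z = 0" "trace Z = 0"
  shows "Z = 0"
  using schur[OF assms(1-3)] assms(4) by (force simp: trace_mat)

lemma generator_nonzero: "S1 \<noteq> 0"
proof
  assume S1: "S1 = 0"
  then have S: "S2 = 0" "S3 = 0" using brackets by (auto simp: commutator_simps)
  obtain i j :: 'n where ij: "i \<noteq> j"
    using card card_le_Suc0_iff_eq[of "UNIV :: 'n set"] by auto
  let ?W = "{w :: complex^'n. w $ i = 0}"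
  have "?W = {0} \<or> ?W = UNIV"
    by (rule invariant_subspace) (auto simp: S S1 vec.subspace_def)
  moreover have "axis j 1 \<in> ?W" "axis i 1 \<notin> ?W" using ij by (auto simp: axis_def)
  moreover have "axis j (1::complex) \<noteq> 0" by (simp add: axis_eq_0_iff)
  ultimately show False by blast
qed

definition casimir :: "complex^'n^'n" where
  "casimir = S1 ** S1 + S2 ** S2 + S3 ** S3"

lemma casimir_scalar: obtains q where "casimir = mat q" "q \<noteq> 0"
proof -
  have "commutator S1 casimir = 0" "commutator S2 casimir = 0" "commutator S3 casimir = 0"
    by (simp_all add: casimir_def commutator_simps commutator_mmul brackets)
  then obtain q where q: "casimir = mat q" by (rule schur)
  have "q \<noteq> 0"
  proof
    assume "q = 0"
    then have "mat 1 \<bullet> casimir = 0" using q by simp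
    moreover have "mat 1 \<bullet> (S ** S) = - (S \<bullet> S)" if "S \<in> su" for S :: "complex^'n^'n"
      using su_dagger[OF that] inner_mmul_left[of S "mat 1" S] by (simp add: inner_matrix_trace)
    ultimately have "S1 \<bullet> S1 + S2 \<bullet> S2 + S3 \<bullet> S3 = 0"
      using generators_su by (simp add: casimir_def inner_add_right)
    moreover have "S1 \<bullet> S1 > 0" using generator_nonzero by simp
    ultimately show False using inner_ge_zero[of S2] inner_ge_zero[of S3] by linarith
  qed
  then show ?thesis using q that by blast
qed

lemma casimir_mmul_eq_0: "casimir ** X = 0 \<Longrightarrow> X = 0"
proof -
  assume 0: "casimir ** X = 0"
  obtain q where q: "casimir = mat q" "q \<noteq> 0" by (rule casimir_scalar)
  then have "mat (1 / q) ** (mat q ** X) = X"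
    by (simp add: matrix_mul_assoc mat_mult_mat)
  then show "X = 0" using 0 q by simp
qed

lemma casimir_central: "casimir ** X = X ** casimir"
  using casimir_scalar mat_central by metis

text \<open>
  Expanding the Laplacian gives \<open>casimir X + X casimir - 2 \<Sum> S X S\<close>. As the Casimir element is
  scalar, this is twice \<open>casimir X - \<Sum> S X S = \<Sum> S [S, X]\<close>.
\<close>
lemma generators_dot_ad:
  "2 *\<^sub>R (S1 ** commutator S1 X + S2 ** commutator S2 X + S3 ** commutator S3 X) = laplacian S1 S2 S3 X"
proof -
  have "S1 ** S1 ** X = X ** S1 ** S1 + X ** S2 ** S2 + X ** S3 ** S3 - S2 ** S2 ** X - S3 ** S3 ** X"
    using casimir_central[of X] by (simp add: casimir_def mmul_expand algebra_simps)
  then show ?thesis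
    by (simp add: laplacian_def commutator_def mmul_expand scaleR_2)
qed

lemma laplacian_linear:
  "laplacian S1 S2 S3 (X + Y) = laplacian S1 S2 S3 X + laplacian S1 S2 S3 Y"
  "laplacian S1 S2 S3 (X - Y) = laplacian S1 S2 S3 X - laplacian S1 S2 S3 Y"
  "laplacian S1 S2 S3 (- X) = - laplacian S1 S2 S3 X"
  "laplacian S1 S2 S3 (c *\<^sub>R X) = c *\<^sub>R laplacian S1 S2 S3 X"
  "laplacian S1 S2 S3 0 = 0"
  "laplacian S1 S2 S3 (mat \<i> ** X) = mat \<i> ** laplacian S1 S2 S3 X"
  by (simp_all add: laplacian_def commutator_simps commutator_i scaleR_add_right matrix_add_ldistrib)

lemma ad_brackets:
  "commutator S1 (commutator S2 X) = commutator S2 (commutator S1 X) + commutator S3 X"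
  "commutator S2 (commutator S3 X) = commutator S3 (commutator S2 X) + commutator S1 X"
  "commutator S3 (commutator S1 X) = commutator S1 (commutator S3 X) + commutator S2 X"
  using commutator_jacobi[of S1 S2 X] commutator_jacobi[of S2 S3 X] commutator_jacobi[of S3 S1 X]
  by (simp_all add: brackets)

lemma laplacian_commutator:
  "laplacian S1 S2 S3 (commutator S1 X) = commutator S1 (laplacian S1 S2 S3 X)"
  "laplacian S1 S2 S3 (commutator S2 X) = commutator S2 (laplacian S1 S2 S3 X)"
  "laplacian S1 S2 S3 (commutator S3 X) = commutator S3 (laplacian S1 S2 S3 X)"
  by (simp_all add: laplacian_def commutator_simps ad_brackets)

lemma laplacian_generators:
  "laplacian S1 S2 S3 S1 = - 2 *\<^sub>R S1" "laplacian S1 S2 S3 S2 = - 2 *\<^sub>R S2"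
  "laplacian S1 S2 S3 S3 = - 2 *\<^sub>R S3"
  by (simp_all add: laplacian_def commutator_simps brackets scaleR_2)

lemma laplacian_energy:
  "X \<bullet> laplacian S1 S2 S3 X = - (commutator S1 X \<bullet> commutator S1 X + commutator S2 X \<bullet> commutator S2 X
    + commutator S3 X \<bullet> commutator S3 X)"
  using inner_commutator_su[OF generators_su(1), of X "commutator S1 X"]
    inner_commutator_su[OF generators_su(2), of X "commutator S2 X"]
    inner_commutator_su[OF generators_su(3), of X "commutator S3 X"]
  by (simp add: laplacian_def inner_add_right)

lemma laplacian_symmetric: "laplacian S1 S2 S3 X \<bullet> Y = X \<bullet> laplacian S1 S2 S3 Y"
  by (simp add: laplacian_def inner_add_left inner_add_right inner_commutator_su generators_su)

lemma laplacian_su: "X \<in> su \<Longrightarrow> laplacian S1 S2 S3 X \<in> su"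
  by (simp add: laplacian_def commutator_su generators_su subspace_add[OF subspace_su])

lemma laplacian_negative_definite:
  assumes "X \<in> su" "X \<noteq> 0"
  shows "X \<bullet> laplacian S1 S2 S3 X < 0"
proof (rule ccontr)
  assume "\<not> ?thesis"
  then have "commutator S1 X \<bullet> commutator S1 X + commutator S2 X \<bullet> commutator S2 X
    + commutator S3 X \<bullet> commutator S3 X \<le> 0"
    unfolding laplacian_energy by simp
  then have "commutator S1 X \<bullet> commutator S1 X = 0 \<and> commutator S2 X \<bullet> commutator S2 X = 0
    \<and> commutator S3 X \<bullet> commutator S3 X = 0"
    using inner_ge_zero[of "commutator S1 X"] inner_ge_zero[of "commutator S2 X"]
      inner_ge_zero[of "commutator S3 X"] by linarith
  then have "commutator S1 X = 0" "commutator S2 X = 0" "commutator S3 X = 0" by simp_all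
  then have "X = 0"
    by (rule schur_traceless) (use assms in \<open>simp add: su_def\<close>)
  then show False using assms by simp
qed

text \<open>
  The whole complex matrix space is used rather than \<open>su\<close>, so that weight vectors are available.
  The set is invariant under the representation, and in the end \<open>0\<close> turns out to be its only element.
\<close>
definition spin_one_complement :: "(complex^'n^'n) set" where
  "spin_one_complement = {X. laplacian S1 S2 S3 X = - 2 *\<^sub>R X \<and>
     trace (S1 ** X) = 0 \<and> trace (S2 ** X) = 0 \<and> trace (S3 ** X) = 0}"

lemma trace_mmul_commutator: "trace (A ** commutator B C) = trace (commutator A B ** (C :: complex^'n^'n))"
  by (simp add: commutator_def mmul_expand trace_mmul_commute[of "A ** C" B])

lemma trace_mmul_i: "trace (A ** (mat \<i> ** B)) = \<i> * trace (A ** (B :: complex^'n^'n))"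
proof -
  have "trace (mat \<i> ** C) = \<i> * trace C" for C :: "complex^'n^'n"
    by (simp add: trace_def matrix_matrix_mult_def mat_def mult_delta_left sum_distrib_left)
  then show ?thesis by (metis mat_central matrix_mul_assoc)
qed

lemma spin_one_complement_closed:
  assumes "X \<in> spin_one_complement"
  shows "commutator S1 X \<in> spin_one_complement" "commutator S2 X \<in> spin_one_complement"
    "commutator S3 X \<in> spin_one_complement" "mat \<i> ** X \<in> spin_one_complement"
  using assms
  by (simp_all add: spin_one_complement_def laplacian_commutator laplacian_linear commutator_simps
      trace_mmul_commutator brackets trace_mmul_i)

lemma subspace_spin_one_complement: "subspace spin_one_complement"
  by (auto simp: subspace_def spin_one_complement_def laplacian_linear matrix_add_ldistrib scaleR_add_right)

text \<open>
  By skewness \<open>\<Sum> \<parallel>[S\<^sub>i, X]\<parallel>\<^sup>2 = 2 \<parallel>X\<parallel>\<^sup>2\<close>, and the summand for \<open>S3\<close> is \<open>\<mu>\<^sup>2 \<parallel>X\<parallel>\<^sup>2\<close>. This rules out the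
  weight \<open>-2\<close>, which the commutation relations alone would permit.
\<close>
lemma spin_one_weight_bound:
  assumes X: "X \<in> spin_one_complement" and w: "mat \<i> ** commutator S3 X = \<mu> *\<^sub>R X"
  shows "\<mu>\<^sup>2 * (X \<bullet> X) \<le> 2 * (X \<bullet> X)"
proof -
  have "commutator S3 X \<bullet> commutator S3 X = (mat \<i> ** commutator S3 X) \<bullet> (mat \<i> ** commutator S3 X)"
    by (simp add: inner_i i_mmul_i)
  also have "\<dots> = \<mu>\<^sup>2 * (X \<bullet> X)" by (simp add: w power2_eq_square)
  finally have "\<mu>\<^sup>2 * (X \<bullet> X) = commutator S3 X \<bullet> commutator S3 X" ..
  moreover have "X \<bullet> laplacian S1 S2 S3 X = - 2 * (X \<bullet> X)"
    using X by (simp add: spin_one_complement_def)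
  ultimately show ?thesis
    using laplacian_energy[of X] inner_ge_zero[of "commutator S1 X"] inner_ge_zero[of "commutator S2 X"]
    by linarith
qed

text \<open>
  The projection theorem for vector operators. The scalar product \<open>Z = S \<cdot> X\<close> commutes with the
  representation and has trace \<open>0\<close>, so it vanishes. By \<open>generators_dot_ad\<close> the triple satisfies
  \<open>X = S \<times> X\<close>; applying this twice gives \<open>casimir X = S Z\<close>, whence \<open>casimir X = 0\<close>.
\<close>
lemma vector_operator_zero:
  fixes X1 X2 X3 :: "complex^'n^'n"
  assumes mem: "X1 \<in> spin_one_complement" "X2 \<in> spin_one_complement" "X3 \<in> spin_one_complement"
    and ad: "commutator S1 X1 = 0" "commutator S1 X2 = X3" "commutator S1 X3 = - X2"
      "commutator S2 X1 = - X3" "commutator S2 X2 = 0" "commutator S2 X3 = X1"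
      "commutator S3 X1 = X2" "commutator S3 X2 = - X1" "commutator S3 X3 = 0"
  shows "X1 = 0"
proof -
  define Z where "Z = S1 ** X1 + S2 ** X2 + S3 ** X3"
  have "Z = 0"
  proof (rule schur_traceless)
    show "commutator S1 Z = 0" "commutator S2 Z = 0" "commutator S3 Z = 0"
      by (simp_all add: Z_def commutator_simps commutator_mmul brackets ad)
    show "trace Z = 0" using mem by (simp add: Z_def spin_one_complement_def)
  qed
  have lap: "S1 ** commutator S1 Y + S2 ** commutator S2 Y + S3 ** commutator S3 Y = - Y"
    if "Y \<in> spin_one_complement" for Y
  proof -
    have "2 *\<^sub>R (S1 ** commutator S1 Y + S2 ** commutator S2 Y + S3 ** commutator S3 Y) = 2 *\<^sub>R (- Y)"
      using that unfolding generators_dot_ad by (simp add: spin_one_complement_def)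
    then show ?thesis by (simp only: scaleR_cancel_left) simp
  qed
  have cross2: "X2 = S3 ** X1 - S1 ** X3" using lap[OF mem(2)] by (simp add: ad algebra_simps)
  have cross3: "X3 = S1 ** X2 - S2 ** X1" using lap[OF mem(3)] by (simp add: ad algebra_simps)
  have S21: "S2 ** S1 = S1 ** S2 - S3" and S31: "S3 ** S1 = S1 ** S3 + S2"
    using brackets(1,3) unfolding commutator_def by (simp_all add: algebra_simps)
  have "S2 ** X3 - S3 ** X2 = S2 ** (S1 ** X2 - S2 ** X1) - S3 ** (S3 ** X1 - S1 ** X3)"
    by (simp only: cross2[symmetric] cross3[symmetric])
  also have "\<dots> = (S2 ** S1) ** X2 + (S3 ** S1) ** X3 - S2 ** S2 ** X1 - S3 ** S3 ** X1"
    by (simp add: mmul_expand)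
  also have "\<dots> = (S1 ** S2 - S3) ** X2 + (S1 ** S3 + S2) ** X3 - S2 ** S2 ** X1 - S3 ** S3 ** X1"
    unfolding S21 S31 ..
  also have "\<dots> = S1 ** Z + (S2 ** X3 - S3 ** X2) - casimir ** X1"
    by (simp add: Z_def casimir_def mmul_expand)
  finally have "casimir ** X1 = S1 ** Z" by (simp add: algebra_simps)
  then show ?thesis using \<open>Z = 0\<close> by (intro casimir_mmul_eq_0[of X1]) simp
qed

text \<open>
  A highest weight vector \<open>X\<close> of weight \<open>1\<close> generates a vector operator with \<open>X = X1 + \<i> X2\<close>. The
  commutation relations and the eigenvalue \<open>-2\<close> determine all nine brackets \<open>[S i, X j]\<close> up to one
  unknown \<open>a = [S1, X1]\<close>; this has weight \<open>-2\<close>, so it is \<open>0\<close>.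
\<close>
lemma highest_weight_zero:
  assumes X: "X \<in> spin_one_complement"
    and raise: "commutator S1 X = - (mat \<i> ** commutator S2 X)" and weight: "commutator S3 X = - (mat \<i> ** X)"
  shows "X = 0"
proof -
  define X3 where "X3 = - commutator S2 X"
  define X1 where "X1 = commutator S2 X3"
  define X2 where "X2 = - commutator S1 X3"
  note neg = subspace_neg[OF subspace_spin_one_complement]
  have mem: "X3 \<in> spin_one_complement" "X1 \<in> spin_one_complement" "X2 \<in> spin_one_complement"
    using X by (simp_all add: X1_def X2_def X3_def neg spin_one_complement_closed commutator_simps)
  note J = commutator_simps commutator_i i_mmul_i matrix_add_ldistrib mmul_diff_right
  have C1X: "commutator S1 X = mat \<i> ** X3" and C2X: "commutator S2 X = - X3"
    using raise by (simp_all add: X3_def)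
  have C1X3: "commutator S1 X3 = - X2" and C2X3: "commutator S2 X3 = X1" by (simp_all add: X1_def X2_def)
  have C3X3: "commutator S3 X3 = 0"
    using ad_brackets(2)[of X] by (simp add: C2X weight C1X J)
  have C3X1: "commutator S3 X1 = X2"
    using ad_brackets(2)[of X3] by (simp add: C3X3 C2X3 C1X3 J algebra_simps)
  have C3X2: "commutator S3 X2 = - X1"
    using ad_brackets(3)[of X3] by (simp add: C3X3 C2X3 C1X3 J eq_neg_iff_add_eq_0 neg_eq_iff_add_eq_0)
  have diff: "commutator S1 X2 - commutator S2 X1 = 2 *\<^sub>R X3"
    using mem(1) by (simp add: spin_one_complement_def laplacian_def C1X3 C2X3 C3X3 J algebra_simps)
  have decomposition: "X = X1 + mat \<i> ** X2"
  proof -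
    have "- (mat \<i> ** X2) - X1 - X = - 2 *\<^sub>R X"
      using X by (simp add: spin_one_complement_def laplacian_def C1X C2X weight C1X3 C2X3 J)
    then show ?thesis by (simp add: scaleR_2 algebra_simps)
  qed
  define a where "a = commutator S1 X1"
  have a_mem: "a \<in> spin_one_complement" using mem by (simp add: a_def spin_one_complement_closed)
  have C1X2: "commutator S1 X2 = X3 + mat \<i> ** a"
  proof -
    have "mat \<i> ** X3 = a + mat \<i> ** commutator S1 X2"
      using C1X by (subst (asm) decomposition) (simp add: J a_def)
    then have "mat \<i> ** (mat \<i> ** X3) = mat \<i> ** (a + mat \<i> ** commutator S1 X2)" by simp
    then show ?thesis by (simp add: i_mmul_i matrix_add_ldistrib algebra_simps)
  qed
  have C2X1: "commutator S2 X1 = - X3 + mat \<i> ** a"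
    using diff unfolding C1X2 by (simp add: scaleR_2 algebra_simps)
  have C2X2: "commutator S2 X2 = - a"
  proof -
    have "- X3 = commutator S2 X1 + mat \<i> ** commutator S2 X2"
      using C2X by (subst (asm) decomposition) (simp add: J)
    then have "mat \<i> ** commutator S2 X2 = - (mat \<i> ** a)"
      unfolding C2X1 by (simp add: eq_neg_iff_add_eq_0 add.commute)
    then have "mat \<i> ** (mat \<i> ** commutator S2 X2) = mat \<i> ** (- (mat \<i> ** a))" by simp
    then show ?thesis by (auto simp: i_mmul_i)
  qed
  have "a = 0"
  proof -
    have "commutator S3 a = 2 *\<^sub>R (mat \<i> ** a)"
      using ad_brackets(3)[of X1] by (simp add: C3X1 C1X2 C2X1 a_def[symmetric] scaleR_2)
    then have "mat \<i> ** commutator S3 a = (- 2) *\<^sub>R a" by (simp add: i_mmul_i)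
    from spin_one_weight_bound[OF a_mem this] have "a \<bullet> a \<le> 0" by simp
    then show ?thesis by (metis inner_eq_zero_iff inner_ge_zero order_antisym)
  qed
  note ad = a_def[symmetric, unfolded \<open>a = 0\<close>] C1X2 C1X3 C2X1 C2X2 C2X3 C3X1 C3X2 C3X3
  have "X1 = 0"
    by (rule vector_operator_zero[OF mem(2,3,1)]) (simp_all add: ad \<open>a = 0\<close>)
  moreover from this have "X2 = 0" using C3X1 by (simp add: commutator_simps)
  ultimately show ?thesis using decomposition by simp
qed

text \<open>
  A top eigenvector of the symmetric operator \<open>X \<mapsto> \<i> [S3, X]\<close> is annihilated by the raising
  operator, because raising would increase the eigenvalue by \<open>1\<close>. The Laplacian then gives
  \<open>\<mu>\<^sup>2 + \<mu> = 2\<close>.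
\<close>
lemma spin_one_complement_trivial:
  assumes "Y \<in> spin_one_complement"
  shows "Y = 0"
proof (rule ccontr)
  assume "Y \<noteq> 0"
  let ?T = "\<lambda>X. mat \<i> ** commutator S3 X"
  obtain X \<mu> where X: "X \<in> spin_one_complement" "X \<noteq> 0" and eig: "?T X = \<mu> *\<^sub>R X"
    and top: "\<And>Y. Y \<in> spin_one_complement \<Longrightarrow> ?T Y \<bullet> Y \<le> \<mu> * (Y \<bullet> Y)"
  proof (rule symmetric_operator_top_eigenvector[of ?T spin_one_complement Y])
    show "linear ?T" by (simp add: linear_iff commutator_simps matrix_add_ldistrib)
    show "?T X \<bullet> Z = X \<bullet> ?T Z" for X Z
      by (simp add: inner_i inner_commutator_su generators_su commutator_i)
  qed (use assms \<open>Y \<noteq> 0\<close> subspace_spin_one_complement spin_one_complement_closed in auto)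
  note J = commutator_simps commutator_i i_mmul_i matrix_add_ldistrib mmul_diff_right
  have C3X: "commutator S3 X = - (\<mu> *\<^sub>R (mat \<i> ** X))"
    using arg_cong[OF eig, of "\<lambda>A. mat \<i> ** A"]
    by (simp add: i_mmul_i eq_neg_iff_add_eq_0 neg_eq_iff_add_eq_0)
  define R where "R = commutator S1 X + mat \<i> ** commutator S2 X"
  have R: "R \<in> spin_one_complement"
    unfolding R_def by (intro subspace_add[OF subspace_spin_one_complement] spin_one_complement_closed X)
  have weights: "commutator S3 (commutator S1 X) = commutator S2 X - \<mu> *\<^sub>R (mat \<i> ** commutator S1 X)"
    "commutator S3 (commutator S2 X) = - (\<mu> *\<^sub>R (mat \<i> ** commutator S2 X)) - commutator S1 X"
    using ad_brackets(2)[of X] ad_brackets(3)[of X] by (simp_all add: C3X J algebra_simps)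
  have "?T R = (\<mu> + 1) *\<^sub>R R"
    by (simp add: R_def J weights algebra_simps)
  then have "R \<bullet> R \<le> 0" using top[OF R] by (simp add: algebra_simps)
  then have "R = 0" by (metis inner_eq_zero_iff inner_ge_zero order_antisym)
  then have raise: "commutator S1 X = - (mat \<i> ** commutator S2 X)"
    by (simp add: R_def eq_neg_iff_add_eq_0)
  have "\<mu> = 1"
  proof -
    have "commutator S1 (commutator S1 X) + commutator S2 (commutator S2 X) = - (\<mu> *\<^sub>R X)"
    proof -
      have "mat \<i> ** commutator S1 X = commutator S2 X" by (simp add: raise i_mmul_i)
      then have "commutator S2 (commutator S2 X) = mat \<i> ** commutator S2 (commutator S1 X)"
        by (metis commutator_i)
      moreover have "commutator S1 (commutator S1 X) = - (mat \<i> ** commutator S1 (commutator S2 X))"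
        by (simp add: raise J)
      ultimately show ?thesis unfolding ad_brackets(1) by (simp add: J C3X)
    qed
    moreover have "commutator S3 (commutator S3 X) = - (\<mu>\<^sup>2 *\<^sub>R X)"
      by (simp add: C3X J power2_eq_square)
    ultimately have "- 2 *\<^sub>R X = - (\<mu> *\<^sub>R X) - \<mu>\<^sup>2 *\<^sub>R X"
      using X by (simp add: spin_one_complement_def laplacian_def)
    then have "(\<mu> + \<mu>\<^sup>2 - 2) *\<^sub>R X = 0" by (simp add: algebra_simps)
    then have "\<mu> + \<mu>\<^sup>2 - 2 = 0" using X(2) by (simp only: scaleR_eq_0_iff) simp
    then have "(\<mu> - 1) * (\<mu> + 2) = 0" by (simp add: algebra_simps power2_eq_square)
    moreover have "\<mu>\<^sup>2 \<le> 2" using spin_one_weight_bound[OF X(1) eig] X(2) by simp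
    then have "\<mu> \<noteq> - 2" by auto
    ultimately show ?thesis by auto
  qed
  then have "X = 0" using highest_weight_zero[OF X(1) raise] C3X by simp
  then show False using X by simp
qed

text \<open>
  The generators are pairwise orthogonal. On \<open>su\<close> the trace of a product is real, so orthogonality
  to the generators in the real inner product puts the remainder into \<open>spin_one_complement\<close>.
\<close>
lemma eigenspace_V_1:
  assumes "u \<in> eigenspace_V S1 S2 S3 1"
  obtains a b c where "u = a *\<^sub>R S1 + b *\<^sub>R S2 + c *\<^sub>R S3"
proof -
  have u: "u \<in> su" "laplacian S1 S2 S3 u = - 2 *\<^sub>R u" using assms by (simp_all add: eigenspace_V_def)
  have orth: "S1 \<bullet> S2 = 0" "S2 \<bullet> S3 = 0" "S3 \<bullet> S1 = 0" 
    using inner_commutator_su[OF generators_su(3), of S1 S1] inner_commutator_su[OF generators_su(1), of S2 S2]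
     inner_commutator_su[OF generators_su(2), of S3 S3]
    by (simp_all add: brackets inner_commute)
  have nz: "S2 \<noteq> 0" "S3 \<noteq> 0" using brackets generator_nonzero by (auto simp: commutator_simps)
  define r where "r = u - ((S1 \<bullet> u) / (S1 \<bullet> S1)) *\<^sub>R S1 - ((S2 \<bullet> u) / (S2 \<bullet> S2)) *\<^sub>R S2
     - ((S3 \<bullet> u) / (S3 \<bullet> S3)) *\<^sub>R S3"
  have r_su: "r \<in> su" unfolding r_def
    by (intro subspace_diff[OF subspace_su] subspace_scale[OF subspace_su] u generators_su)
  have tr: "trace (S ** r) = 0" if "S \<in> su" "S \<bullet> r = 0" for S :: "complex^'n^'n"
  proof -
    have "Re (trace (S ** r)) = 0" using that by (simp add: inner_matrix_trace su_dagger)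
    moreover have "cnj (trace (S ** r)) = trace (S ** r)"
      using that(1) r_su by (simp add: su_dagger trace_mmul_commute[of r] flip: trace_dagger)
    then have "Im (trace (S ** r)) = 0" by (simp add: complex_eq_iff)
    ultimately show ?thesis by (simp add: complex_eq_iff)
  qed
  have "S1 \<bullet> r = 0" "S2 \<bullet> r = 0" "S3 \<bullet> r = 0"
    using orth nz generator_nonzero
    by (simp_all add: r_def inner_diff_right inner_commute[of S2 S1] inner_commute[of S3 S2] inner_commute[of S1 S3])
  then have "trace (S1 ** r) = 0" "trace (S2 ** r) = 0" "trace (S3 ** r) = 0"
    using tr generators_su by blast+
  moreover have "laplacian S1 S2 S3 r = - 2 *\<^sub>R r"
    by (simp add: r_def laplacian_linear u laplacian_generators scaleR_diff_right mult.commute)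
  ultimately have "r = 0"
    by (intro spin_one_complement_trivial[of r]) (simp add: spin_one_complement_def)
  then have "u = ((S1 \<bullet> u) / (S1 \<bullet> S1)) *\<^sub>R S1 + ((S2 \<bullet> u) / (S2 \<bullet> S2)) *\<^sub>R S2
     + ((S3 \<bullet> u) / (S3 \<bullet> S3)) *\<^sub>R S3" by (simp add: r_def algebra_simps)
  then show ?thesis using that by blast
qed

lemma laplacian_commutator_eigenspace_V_1:
  assumes "u \<in> eigenspace_V S1 S2 S3 1"
  shows "laplacian S1 S2 S3 (commutator u X) = commutator u (laplacian S1 S2 S3 X)"
proof -
  obtain a b c where "u = a *\<^sub>R S1 + b *\<^sub>R S2 + c *\<^sub>R S3" using eigenspace_V_1[OF assms] .
  then show ?thesis by (simp add: commutator_simps laplacian_linear laplacian_commutator)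
qed

lemma su_center_trivial:
  fixes u :: "complex^'n^'n"
  assumes "u \<in> su" "\<And>y. y \<in> su \<Longrightarrow> commutator u y = 0"
  shows "u = 0"
proof (rule schur_traceless)
  show "trace u = 0" using assms by (simp add: su_def)
qed (use assms(2) generators_su commutator_swap[of _ u] in simp_all)

end

section \<open>The trace in terms of an inner product\<close>

text \<open>
  A largest orthonormal set spans: otherwise the normalized remainder of a vector outside its span
  could be added. In the application the form is the metric on \<open>su\<close>.
\<close>
lemma orthonormal_basis_of_form:
  fixes k :: "'a::euclidean_space \<Rightarrow> 'a \<Rightarrow> real"
  assumes V: "subspace V" and lin: "\<And>y. linear (\<lambda>x. k x y)" and sym: "\<And>x y. k x y = k y x"
    and pos: "\<And>x. x \<in> V \<Longrightarrow> x \<noteq> 0 \<Longrightarrow> k x x > 0"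
  obtains E where "finite E" "E \<subseteq> V" "\<And>x. x \<in> V \<Longrightarrow> x = (\<Sum>e\<in>E. k x e *\<^sub>R e)"
proof -
  define orthonormal where "orthonormal E \<longleftrightarrow> finite E \<and> E \<subseteq> V \<and>
      (\<forall>e\<in>E. \<forall>f\<in>E. k e f = (if e = f then 1 else 0))" for E
  have lin2: "linear (\<lambda>y. k x y)" for x using lin[of x] by (simp add: sym[of _ x])
  have card_le: "card E \<le> DIM('a)" if "orthonormal E" for E
  proof -
    have "independent E"
    proof (rule real_vector.independent_if_scalars_zero)
      show "finite E" using that by (simp add: orthonormal_def)
      fix c e assume "(\<Sum>x\<in>E. c x *\<^sub>R x) = 0" "e \<in> E"
      then have "0 = k (\<Sum>x\<in>E. c x *\<^sub>R x) e" using linear_0[OF lin] by simp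
      also have "\<dots> = (\<Sum>x\<in>E. c x * k x e)"
        by (simp add: linear_sum[OF lin] linear_scale[OF lin])
      also have "\<dots> = (\<Sum>x\<in>E. if x = e then c x else 0)"
        using that \<open>e \<in> E\<close> by (intro sum.cong) (auto simp: orthonormal_def)
      also have "\<dots> = c e" using \<open>e \<in> E\<close> \<open>finite E\<close> by simp
      finally show "c e = 0" ..
    qed
    then show ?thesis by (rule independent_card_le)
  qed
  have "orthonormal {}" by (simp add: orthonormal_def)
  then obtain E where E: "orthonormal E" and max: "\<And>F. orthonormal F \<Longrightarrow> card F \<le> card E"
    using ex_has_greatest_nat[of orthonormal "{}" card "Suc DIM('a)"] card_le le_imp_less_Suc by blast
  have expansion: "x = (\<Sum>e\<in>E. k x e *\<^sub>R e)" if x: "x \<in> V" for x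
  proof (rule ccontr)
    assume neq: "\<not> ?thesis"
    define r where "r = x - (\<Sum>e\<in>E. k x e *\<^sub>R e)"
    have rV: "r \<in> V" unfolding r_def
      using E x V by (intro subspace_diff subspace_sum subspace_scale) (auto simp: orthonormal_def)
    have "r \<noteq> 0" using neq by (simp add: r_def)
    then have "k r r > 0" using pos rV by blast
    have rE: "k r f = 0" if "f \<in> E" for f
    proof -
      have "(\<Sum>e\<in>E. k x e * k e f) = (\<Sum>e\<in>E. if e = f then k x e else 0)"
        using E that by (intro sum.cong) (auto simp: orthonormal_def)
      also have "\<dots> = k x f" using E that by (simp add: orthonormal_def)
      finally show ?thesis
        by (simp add: r_def linear_diff[OF lin] linear_sum[OF lin] linear_scale[OF lin])
    qed
    define e where "e = r /\<^sub>R sqrt (k r r)"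
    have "k e e = 1" using \<open>k r r > 0\<close>
      by (simp add: e_def linear_scale[OF lin] linear_scale[OF lin2] field_simps)
    moreover have "k e f = 0" "k f e = 0" if "f \<in> E" for f
      using rE[OF that] sym[of f e] by (simp_all add: e_def linear_scale[OF lin])
    ultimately have "orthonormal (insert e E)" "e \<notin> E"
      using E rV V by (auto simp: orthonormal_def e_def subspace_scale)
    from max[OF this(1)] this(2) show False using E by (simp add: orthonormal_def)
  qed
  show ?thesis using that[of E] E expansion by (auto simp: orthonormal_def)
qed

text \<open>
  Expanding the orthonormal vectors in the basis \<open>B\<close> that defines the trace, and the images of the
  elements of \<open>B\<close> in the orthonormal vectors, turns either side into the same double sum.
\<close>
lemma trace_on_orthonormal:
  fixes f :: "'a::euclidean_space \<Rightarrow> 'a"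
  assumes V: "subspace V" and lin: "\<And>y. linear (\<lambda>x. k x y)" and f: "linear f"
    and fV: "\<And>x. x \<in> V \<Longrightarrow> f x \<in> V" and gf: "\<And>x. x \<in> V \<Longrightarrow> g x = f x"
    and E: "finite E" "E \<subseteq> V" "\<And>x. x \<in> V \<Longrightarrow> x = (\<Sum>e\<in>E. k x e *\<^sub>R e)"
  shows "trace_on V g = (\<Sum>e\<in>E. k (f e) e)"
proof -
  define B where "B = (SOME B. independent B \<and> span B = V)"
  have "\<exists>B. independent B \<and> span B = V"
    using basis_exists[of V] span_subspace[OF _ _ V] by metis
  then have B: "independent B" "span B = V"
    unfolding B_def by (metis (mono_tags, lifting) someI_ex)+
  have finB: "finite B" using B(1) by (rule independent_imp_finite)
  have BV: "b \<in> V" if "b \<in> B" for b using that B(2) span_base by blast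
  have spanE: "e \<in> span B" if "e \<in> E" for e using that E(2) B(2) by blast
  have "(\<Sum>e\<in>E. k (f e) e) = (\<Sum>e\<in>E. \<Sum>b\<in>B. representation B e b * k (f b) e)"
  proof (rule sum.cong)
    fix e assume "e \<in> E"
    then have "e = (\<Sum>b\<in>B. representation B e b *\<^sub>R b)"
      using real_vector.sum_representation_eq[OF B(1) _ finB subset_refl] B(2) E(2) by force
    then have "f e = (\<Sum>b\<in>B. representation B e b *\<^sub>R f b)"
      by (metis (no_types, lifting) f linear_scale linear_sum sum.cong)
    then have "k (f e) e = k (\<Sum>b\<in>B. representation B e b *\<^sub>R f b) e" by simp
    then show "k (f e) e = (\<Sum>b\<in>B. representation B e b * k (f b) e)"
      by (simp add: linear_sum[OF lin] linear_scale[OF lin])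
  qed simp
  also have "\<dots> = (\<Sum>b\<in>B. \<Sum>e\<in>E. k (f b) e * representation B e b)"
    by (subst sum.swap) (simp add: mult.commute)
  also have "\<dots> = (\<Sum>b\<in>B. representation B (\<Sum>e\<in>E. k (f b) e *\<^sub>R e) b)"
    by (simp add: real_vector.representation_sum[OF B(1)] real_vector.representation_scale[OF B(1)]
        span_scale spanE)
  also have "\<dots> = (\<Sum>b\<in>B. representation B (g b) b)"
    using E(3)[OF fV[OF BV], symmetric] gf[OF BV] by (intro sum.cong) simp_all
  finally show ?thesis by (simp add: trace_on_def B_def[symmetric] Let_def)
qed

section \<open>Vector fields on the special unitary group\<close>
lemma SU_dagger: "p \<in> SU \<Longrightarrow> dagger p ** p = mat 1" "p \<in> SU \<Longrightarrow> p ** dagger p = mat 1"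
  by (simp_all add: SU_def matrix_left_right_inverse)

lemma SU_cancel [simp]:
  fixes p A :: "complex^'n^'n"
  shows "p \<in> SU \<Longrightarrow> A ** p ** dagger p = A" "p \<in> SU \<Longrightarrow> A ** dagger p ** p = A"
  by (simp_all add: SU_dagger flip: matrix_mul_assoc)

lemma one_SU: "mat 1 \<in> SU"
  by (simp add: SU_def)

lemma SU_tangent_iff: "p \<in> SU \<Longrightarrow> v \<in> SU_tangent p \<longleftrightarrow> v ** dagger p \<in> su"
  unfolding SU_tangent_def by (auto intro!: exI[of _ "v ** dagger p"])

lemma SU_tangentI: "u \<in> su \<Longrightarrow> u ** p \<in> SU_tangent p"
  unfolding SU_tangent_def by blast

lemma SU_frechet_derivative:
  fixes f :: "complex^'n^'n \<Rightarrow> 'b::real_normed_vector"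
  assumes "(f has_derivative f') (at p within SU)" "p \<in> SU" "v \<in> SU_tangent p"
  shows "frechet_derivative f (at p within SU) v = f' v"
proof -
  have "(f has_derivative frechet_derivative f (at p within SU)) (at p within SU)"
    using assms(1) differentiableI frechet_derivative_works by blast
  then show ?thesis using SU_derivative_unique assms by blast
qed

lemma SU_frechet_derivative_cong:
  fixes f :: "complex^'n^'n \<Rightarrow> 'b::real_normed_vector"
  assumes "(f has_derivative f') (at p within SU)" "\<And>q. q \<in> SU \<Longrightarrow> g q = f q" "p \<in> SU" "v \<in> SU_tangent p"
  shows "frechet_derivative g (at p within SU) v = f' v"
  using SU_frechet_derivative[OF has_derivative_transform[OF assms(3,2,1)]] assms(3,4) by blast

abbreviation SU_field :: "(complex^'n^'n \<Rightarrow> complex^'n^'n) \<Rightarrow> bool" where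
  "SU_field \<equiv> vector_field SU SU_tangent"

text \<open>
  Right translation to the identity turns a vector field into a function with values in \<open>su\<close>.
\<close>
definition right_trivialization :: "(complex^'n^'n \<Rightarrow> complex^'n^'n) \<Rightarrow> complex^'n^'n \<Rightarrow> complex^'n^'n" where
  "right_trivialization X q = X q ** dagger q"

lemma right_trivialization_su: "SU_field X \<Longrightarrow> p \<in> SU \<Longrightarrow> right_trivialization X p \<in> su"
  by (simp add: vector_field_def right_trivialization_def flip: SU_tangent_iff)

lemma right_trivialization_mmul: "p \<in> SU \<Longrightarrow> right_trivialization X p ** p = X p"
  by (simp add: right_trivialization_def)

abbreviation SU_deriv :: "(complex^'n^'n \<Rightarrow> 'b::real_normed_vector) \<Rightarrow> complex^'n^'n \<Rightarrow> complex^'n^'n \<Rightarrow> 'b" where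
  "SU_deriv f p \<equiv> frechet_derivative f (at p within SU)"

lemma right_trivialization_has_derivative:
  assumes "SU_field X" "p \<in> SU"
  shows "(right_trivialization X has_derivative SU_deriv (right_trivialization X) p) (at p within SU)"
proof -
  have "X differentiable (at p within SU)" using assms by (simp add: vector_field_def differentiable_on_def)
  then obtain X' where "(X has_derivative X') (at p within SU)" unfolding differentiable_def ..
  then have "(right_trivialization X has_derivative (\<lambda>h. X p ** dagger h + X' h ** dagger p)) (at p within SU)"
    unfolding right_trivialization_def by (auto intro!: derivative_intros)
  then show ?thesis using differentiableI frechet_derivative_works by blast
qed

text \<open>The linear equations that define \<open>su\<close> are constant along \<open>SU\<close>, so they can be differentiated.\<close>
lemma SU_deriv_right_trivialization_su:
  assumes X: "SU_field X" and p: "p \<in> SU" and v: "v \<in> SU_tangent p"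
  shows "SU_deriv (right_trivialization X) p v \<in> su"
proof -
  let ?x = "right_trivialization X" and ?x' = "SU_deriv (right_trivialization X) p"
  note d = right_trivialization_has_derivative[OF X p]
  have lin_trace: "bounded_linear (trace :: complex^'n^'n \<Rightarrow> complex)"
    by (intro linear_conv_bounded_linear[THEN iffD1]) (simp add: linear_iff)
  have "((\<lambda>q. dagger (?x q) + ?x q) has_derivative (\<lambda>h. dagger (?x' h) + ?x' h)) (at p within SU)"
    "((\<lambda>q. trace (?x q)) has_derivative (\<lambda>h. trace (?x' h))) (at p within SU)"
    using d by (auto intro!: derivative_intros bounded_linear.has_derivative[OF lin_trace])
  moreover have "((\<lambda>q. dagger (?x q) + ?x q) has_derivative (\<lambda>h. 0)) (at p within SU)"
    "((\<lambda>q. trace (?x q)) has_derivative (\<lambda>h. 0)) (at p within SU)"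
    using right_trivialization_su[OF X]
    by (auto intro!: has_derivative_transform[OF p _ has_derivative_const[of 0]] simp: su_def)
  ultimately have "dagger (?x' v) + ?x' v = 0" "trace (?x' v) = 0"
    using SU_derivative_unique[OF _ _ p v] by blast+
  then show ?thesis by (simp add: su_def eq_neg_iff_add_eq_0)
qed

lemma SU_deriv_field:
  assumes X: "SU_field X" and p: "p \<in> SU" and v: "v \<in> SU_tangent p"
  shows "SU_deriv X p v = SU_deriv (right_trivialization X) p v ** p + right_trivialization X p ** v"
proof -
  let ?x = "right_trivialization X"
  have "((\<lambda>q. ?x q ** q) has_derivative (\<lambda>h. ?x p ** h + SU_deriv ?x p h ** p)) (at p within SU)"
    by (intro has_derivative_mmul right_trivialization_has_derivative X p has_derivative_ident)
  from SU_frechet_derivative_cong[OF this _ p v, of X] show ?thesis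
    by (simp add: right_trivialization_mmul add.commute)
qed

text \<open>
  Covariant derivatives and brackets of right-invariant fields are known only on \<open>SU\<close>. The
  predicate therefore asks for agreement with a right-invariant field there and leaves the other
  values free.
\<close>
definition invariant_extension ::
    "complex^'n^'n \<Rightarrow> (complex^'n^'n \<Rightarrow> complex^'n^'n) \<Rightarrow> bool" where
  "invariant_extension x X \<longleftrightarrow> x \<in> su \<and> (\<forall>q\<in>SU. X q = x ** q)"

lemma invariant_extension_right_invariant_field:
  "x \<in> su \<Longrightarrow> invariant_extension x (right_invariant_field x)"
  by (simp add: invariant_extension_def right_invariant_field_def)

lemma invariant_extension_has_derivative:
  assumes "invariant_extension x X" "p \<in> SU"
  shows "(X has_derivative (\<lambda>h. x ** h)) (at p within SU)"
proof (rule has_derivative_transform[OF assms(2)])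
  show "((\<lambda>q. x ** q) has_derivative (\<lambda>h. x ** h)) (at p within SU)"
    by (auto intro!: derivative_eq_intros)
qed (use assms in \<open>simp add: invariant_extension_def\<close>)

lemma invariant_extension_field:
  assumes "invariant_extension x X"
  shows "SU_field X"
  unfolding vector_field_def differentiable_on_def
  using invariant_extension_has_derivative[OF assms] assms
  by (auto simp: invariant_extension_def SU_tangentI intro: differentiableI)

lemma lie_bracket_invariant:
  assumes X: "invariant_extension x X" and Y: "invariant_extension y Y" and p: "p \<in> SU"
  shows "lie_bracket SU X Y p = - commutator x y ** p"
proof -
  have "SU_deriv Y p (X p) = y ** X p" "SU_deriv X p (Y p) = x ** Y p"
    using SU_frechet_derivative[OF invariant_extension_has_derivative[OF Y p] p]
      SU_frechet_derivative[OF invariant_extension_has_derivative[OF X p] p]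
      invariant_extension_field[OF X] invariant_extension_field[OF Y] p by (auto simp: vector_field_def)
  then show ?thesis using X Y p
    by (simp add: lie_bracket_def invariant_extension_def commutator_def mmul_expand)
qed

section \<open>Right-invariant metrics and their Ricci curvature\<close>

text \<open>
  An inner product on \<open>su\<close> in the form \<open>x \<bullet> T y\<close>. The Riesz representatives with respect to it, on
  which the Levi-Civita form depends, are then given by the inverse of \<open>T\<close> on \<open>su\<close>.
\<close>
locale right_invariant_metric =
  fixes T :: "complex^'n^'n \<Rightarrow> complex^'n^'n"
  assumes T_linear: "linear T" and T_su: "x \<in> su \<Longrightarrow> T x \<in> su"
    and T_symmetric: "T x \<bullet> y = x \<bullet> T y" and T_positive: "x \<in> su \<Longrightarrow> x \<noteq> 0 \<Longrightarrow> x \<bullet> T x > 0"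
begin

definition metric :: "complex^'n^'n \<Rightarrow> complex^'n^'n \<Rightarrow> complex^'n^'n \<Rightarrow> real" where
  "metric g X Y = (X ** dagger g) \<bullet> T (Y ** dagger g)"

lemma T_injective: "inj_on T su"
proof (rule inj_onI)
  fix x y assume xy: "x \<in> su" "y \<in> su" "T x = T y"
  then have "(x - y) \<bullet> T (x - y) = 0" by (simp add: linear_diff[OF T_linear])
  then show "x = y" using T_positive[of "x - y"] xy subspace_diff[OF subspace_su, of x y] by force
qed

lemma T_surjective: "T ` su = su"
proof (rule eucl.subspace_dim_equal)
  show "subspace (T ` su)" using T_linear subspace_su by (rule linear_subspace_image)
  have "span su = (su :: (complex^'n^'n) set)" using subspace_su by (simp add: span_eq_iff)
  then have "inj_on T (span su)" using T_injective by (simp only:)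
  then show "dim (su :: (complex^'n^'n) set) \<le> dim (T ` su)"
    using eucl.dim_image_eq[OF T_linear, of su] by simp
qed (use T_su subspace_su in auto)

lemma inverse_inertia_exists:
  "\<exists>J. linear J \<and> (\<forall>x. J x \<in> su) \<and> (\<forall>x\<in>su. J (T x) = x \<and> T (J x) = x)"
proof -
  obtain J where J: "range J \<subseteq> su" "linear J" "\<And>x. x \<in> su \<Longrightarrow> J (T x) = x"
    using real_vector.linear_exists_left_inverse_on[OF T_linear subspace_su T_injective] by blast
  have "T (J x) = x" if "x \<in> su" for x
    using that J(3) T_surjective by (metis imageE)
  with J show ?thesis by blast
qed

definition inverse_inertia :: "complex^'n^'n \<Rightarrow> complex^'n^'n" where
  "inverse_inertia = (SOME J. linear J \<and> (\<forall>x. J x \<in> su) \<and> (\<forall>x\<in>su. J (T x) = x \<and> T (J x) = x))"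

lemma inverse_inertia_linear: "linear inverse_inertia"
  and inverse_inertia_su: "inverse_inertia x \<in> su"
  and inverse_inertia_T: "x \<in> su \<Longrightarrow> inverse_inertia (T x) = x"
  and T_inverse_inertia: "x \<in> su \<Longrightarrow> T (inverse_inertia x) = x"
  using someI_ex[OF inverse_inertia_exists, folded inverse_inertia_def] by blast+

lemmas T_simps =
  linear_add[OF T_linear] linear_diff[OF T_linear] linear_scale[OF T_linear]
  linear_neg[OF T_linear] linear_0[OF T_linear]
lemmas inverse_inertia_simps =
  linear_add[OF inverse_inertia_linear] linear_diff[OF inverse_inertia_linear] linear_scale[OF inverse_inertia_linear]
  linear_neg[OF inverse_inertia_linear] linear_0[OF inverse_inertia_linear]

lemma su_closed:
  "x \<in> su \<Longrightarrow> y \<in> su \<Longrightarrow> x + y \<in> su" "x \<in> su \<Longrightarrow> y \<in> su \<Longrightarrow> x - y \<in> su" "x \<in> su \<Longrightarrow> - x \<in> su"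
  "x \<in> su \<Longrightarrow> c *\<^sub>R x \<in> su" "(0 :: complex^'n^'n) \<in> su"
  for x y :: "complex^'n^'n"
  using subspace_su by (blast intro: subspace_add subspace_diff subspace_neg subspace_scale subspace_0)+

text \<open>
  The solution of the Koszul formula on right-invariant fields, whose Lie bracket is the negative
  of the matrix commutator.
\<close>
definition levi_civita_form :: "complex^'n^'n \<Rightarrow> complex^'n^'n \<Rightarrow> complex^'n^'n" where
  "levi_civita_form x y = - (1/2) *\<^sub>R (commutator x y + inverse_inertia (commutator x (T y) - commutator (T x) y))"

lemma levi_civita_form_su: "x \<in> su \<Longrightarrow> y \<in> su \<Longrightarrow> levi_civita_form x y \<in> su"
  unfolding levi_civita_form_def by (intro su_closed commutator_su inverse_inertia_su)

lemma levi_civita_form_simps: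
  "levi_civita_form (x + x') y = levi_civita_form x y + levi_civita_form x' y"
  "levi_civita_form x (y + y') = levi_civita_form x y + levi_civita_form x y'"
  "levi_civita_form (c *\<^sub>R x) y = c *\<^sub>R levi_civita_form x y"
  "levi_civita_form x (c *\<^sub>R y) = c *\<^sub>R levi_civita_form x y"
  "levi_civita_form (- x) y = - levi_civita_form x y" "levi_civita_form x (- y) = - levi_civita_form x y"
  "levi_civita_form 0 y = 0" "levi_civita_form x 0 = 0"
  by (simp_all add: levi_civita_form_def commutator_simps T_simps inverse_inertia_simps algebra_simps)

lemma levi_civita_form_torsion_free: "levi_civita_form x y - levi_civita_form y x = - commutator x y"
proof -
  have "levi_civita_form y x = - (1/2) *\<^sub>R (- commutator x y + inverse_inertia (commutator x (T y) - commutator (T x) y))"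
    unfolding levi_civita_form_def commutator_swap[of y] commutator_swap[of "T y"] by simp
  then have "levi_civita_form x y - levi_civita_form y x = - (1/2) *\<^sub>R (2 *\<^sub>R commutator x y)"
    unfolding levi_civita_form_def scaleR_2 scaleR_diff_right[symmetric] by simp
  then show ?thesis by simp
qed

lemma levi_civita_form_metric:
  assumes x: "x \<in> su" and y: "y \<in> su" and z: "z \<in> su"
  shows "levi_civita_form x y \<bullet> T z + y \<bullet> T (levi_civita_form x z) = 0"
proof -
  have TB: "T (levi_civita_form x w) = - (1/2) *\<^sub>R (T (commutator x w) + (commutator x (T w) - commutator (T x) w))"
    if "w \<in> su" for w
  proof -
    have "commutator x (T w) - commutator (T x) w \<in> su"
      using that x by (intro su_closed commutator_su T_su)
    then show ?thesis by (simp add: levi_civita_form_def T_simps T_inverse_inertia)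
  qed
  have "T (levi_civita_form x y) \<bullet> z = - (1/2) * (T (commutator x y) \<bullet> z + commutator x (T y) \<bullet> z - commutator (T x) y \<bullet> z)"
    by (simp add: TB y inner_add_left inner_diff_left)
  moreover have "y \<bullet> T (levi_civita_form x z) = - (1/2) * (y \<bullet> T (commutator x z) + y \<bullet> commutator x (T z) - y \<bullet> commutator (T x) z)"
    by (simp add: TB z inner_add_right inner_diff_right)
  moreover have "T (commutator x y) \<bullet> z = - (y \<bullet> commutator x (T z))"
    by (simp add: T_symmetric inner_commutator_su x)
  moreover have "commutator x (T y) \<bullet> z = - (y \<bullet> T (commutator x z))"
    by (simp add: inner_commutator_su x T_symmetric)
  moreover have "commutator (T x) y \<bullet> z = - (y \<bullet> commutator (T x) z)"
    by (simp add: inner_commutator_su T_su x)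
  ultimately show ?thesis by (simp add: T_symmetric field_simps)
qed

text \<open>
  In the right trivialization the tangent bundle is a product, and the connection is the flat
  derivative corrected by \<open>levi_civita_form\<close>.
\<close>
definition connection :: "(complex^'n^'n \<Rightarrow> complex^'n^'n) \<Rightarrow> (complex^'n^'n \<Rightarrow> complex^'n^'n) \<Rightarrow> complex^'n^'n \<Rightarrow> complex^'n^'n" where
  "connection X Y p = (SU_deriv (right_trivialization Y) p (X p)
      + levi_civita_form (right_trivialization X p) (right_trivialization Y p)) ** p"

lemma SU_deriv_add:
  assumes "SU_field X" "SU_field Y" "p \<in> SU" "v \<in> SU_tangent p"
  shows "SU_deriv (right_trivialization (\<lambda>q. X q + Y q)) p v
    = SU_deriv (right_trivialization X) p v + SU_deriv (right_trivialization Y) p v"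
  by (rule SU_frechet_derivative_cong[OF has_derivative_add[OF right_trivialization_has_derivative
        right_trivialization_has_derivative]])
    (use assms in \<open>auto simp: right_trivialization_def mmul_rdistrib\<close>)

lemma SU_deriv_scale:
  assumes f: "f differentiable_on SU" and X: "SU_field X" and p: "p \<in> SU" and v: "v \<in> SU_tangent p"
  shows "SU_deriv (right_trivialization (\<lambda>q. f q *\<^sub>R X q)) p v
    = SU_deriv f p v *\<^sub>R right_trivialization X p + f p *\<^sub>R SU_deriv (right_trivialization X) p v"
proof -
  have "(f has_derivative SU_deriv f p) (at p within SU)"
    using f p by (simp add: differentiable_on_def frechet_derivative_works)
  from has_derivative_scaleR[OF this right_trivialization_has_derivative[OF X p]]
  have "SU_deriv (\<lambda>q. f q *\<^sub>R right_trivialization X q) p v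
    = f p *\<^sub>R SU_deriv (right_trivialization X) p v + SU_deriv f p v *\<^sub>R right_trivialization X p"
    using p v by (rule SU_frechet_derivative)
  moreover have "right_trivialization (\<lambda>q. f q *\<^sub>R X q) = (\<lambda>q. f q *\<^sub>R right_trivialization X q)"
    by (simp add: right_trivialization_def fun_eq_iff)
  ultimately show ?thesis by (simp add: add.commute)
qed

lemma connection_affine: "affine_connection SU SU_tangent connection"
  unfolding affine_connection_def
proof (intro conjI allI impI ballI)
  fix X X' Y Y' :: "complex^'n^'n \<Rightarrow> complex^'n^'n" and f :: "complex^'n^'n \<Rightarrow> real" and p :: "complex^'n^'n"
  assume p: "p \<in> SU" and X: "SU_field X" and Y: "SU_field Y"
  have Xp: "X p \<in> SU_tangent p" using X p by (simp add: vector_field_def)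
  have lin: "linear (SU_deriv (right_trivialization Y) p)"
    using right_trivialization_has_derivative[OF Y p] by (rule has_derivative_linear)
  show "connection X Y p \<in> SU_tangent p"
    unfolding connection_def
    by (intro SU_tangentI su_closed SU_deriv_right_trivialization_su levi_civita_form_su right_trivialization_su X Y p Xp)
  show "connection (\<lambda>q. X q + X' q) Y p = connection X Y p + connection X' Y p"
    by (simp add: connection_def linear_add[OF lin])
      (simp add: right_trivialization_def mmul_rdistrib levi_civita_form_simps)
  show "connection (\<lambda>q. f q *\<^sub>R X q) Y p = f p *\<^sub>R connection X Y p"
    by (simp add: connection_def linear_scale[OF lin])
      (simp add: right_trivialization_def mmul_rdistrib levi_civita_form_simps scaleR_add_right)
  show "connection X (\<lambda>q. Y q + Y' q) p = connection X Y p + connection X Y' p" if "SU_field Y'"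
    by (simp add: connection_def SU_deriv_add[OF Y that p Xp])
      (simp add: right_trivialization_def mmul_rdistrib levi_civita_form_simps)
  show "connection X (\<lambda>q. f q *\<^sub>R Y q) p = SU_deriv f p (X p) *\<^sub>R Y p + f p *\<^sub>R connection X Y p"
    if "f differentiable_on SU"
    using p by (simp add: connection_def SU_deriv_scale[OF that Y p Xp])
      (simp add: right_trivialization_def mmul_rdistrib levi_civita_form_simps scaleR_add_right)
qed

lemma connection_levi_civita: "is_levi_civita SU SU_tangent metric connection"
  unfolding is_levi_civita_def
proof (intro conjI connection_affine allI impI ballI)
  fix X Y Z :: "complex^'n^'n \<Rightarrow> complex^'n^'n" and p :: "complex^'n^'n"
  assume p: "p \<in> SU" and X: "SU_field X" and Y: "SU_field Y"
  have Xp: "X p \<in> SU_tangent p" and Yp: "Y p \<in> SU_tangent p" using X Y p by (simp_all add: vector_field_def)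
  let ?x = "right_trivialization X" and ?y = "right_trivialization Y" and ?z = "right_trivialization Z"
  have "connection X Y p - connection Y X p
     = (SU_deriv ?y p (X p) - SU_deriv ?x p (Y p) + (levi_civita_form (?x p) (?y p) - levi_civita_form (?y p) (?x p))) ** p"
    by (simp add: connection_def mmul_expand)
  also have "\<dots> = (SU_deriv ?y p (X p) ** p + ?y p ** (?x p ** p)) - (SU_deriv ?x p (Y p) ** p + ?x p ** (?y p ** p))"
    unfolding levi_civita_form_torsion_free by (simp add: commutator_def mmul_expand)
  also have "\<dots> = lie_bracket SU X Y p"
    unfolding lie_bracket_def SU_deriv_field[OF Y p Xp] SU_deriv_field[OF X p Yp] right_trivialization_mmul[OF p] ..
  finally show "connection X Y p - connection Y X p = lie_bracket SU X Y p" .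
  assume Z: "SU_field Z"
  note dT = bounded_linear.has_derivative[OF T_linear[unfolded linear_conv_bounded_linear]]
  have "((\<lambda>q. ?y q \<bullet> T (?z q)) has_derivative
      (\<lambda>h. ?y p \<bullet> T (SU_deriv ?z p h) + SU_deriv ?y p h \<bullet> T (?z p))) (at p within SU)"
    by (intro has_derivative_inner dT right_trivialization_has_derivative Y Z p)
  from SU_frechet_derivative_cong[OF this _ p Xp, of "\<lambda>q. metric q (Y q) (Z q)"]
  have "SU_deriv (\<lambda>q. metric q (Y q) (Z q)) p (X p)
     = ?y p \<bullet> T (SU_deriv ?z p (X p)) + SU_deriv ?y p (X p) \<bullet> T (?z p)"
    by (simp add: metric_def right_trivialization_def)
  moreover have trivialized: "connection X W p ** dagger p
      = SU_deriv (right_trivialization W) p (X p) + levi_civita_form (?x p) (right_trivialization W p)" for W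
    using p by (simp add: connection_def)
  have "metric p (connection X Y p) (Z p)
      = SU_deriv ?y p (X p) \<bullet> T (?z p) + levi_civita_form (?x p) (?y p) \<bullet> T (?z p)"
    unfolding metric_def trivialized by (simp add: inner_add_left right_trivialization_def)
  moreover have "metric p (Y p) (connection X Z p)
      = ?y p \<bullet> T (SU_deriv ?z p (X p)) + ?y p \<bullet> T (levi_civita_form (?x p) (?z p))"
    unfolding metric_def trivialized by (simp add: T_simps inner_add_right right_trivialization_def)
  moreover have "levi_civita_form (?x p) (?y p) \<bullet> T (?z p) + ?y p \<bullet> T (levi_civita_form (?x p) (?z p)) = 0"
    by (intro levi_civita_form_metric right_trivialization_su X Y Z p)
  ultimately show "SU_deriv (\<lambda>q. metric q (Y q) (Z q)) p (X p)
     = metric p (connection X Y p) (Z p) + metric p (Y p) (connection X Z p)" by linarith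
qed

text \<open>
  Koszul's uniqueness argument. The difference \<open>e\<close> of two candidates is symmetric, by
  torsion-freeness, and skew, by metric compatibility, as the metric of right-invariant fields is
  constant on \<open>SU\<close>. A trilinear expression symmetric in one pair of arguments and skew in an
  overlapping pair is \<open>0\<close>.
\<close>
lemma levi_civita_invariant:
  assumes D: "is_levi_civita SU SU_tangent metric D"
    and X: "invariant_extension x X" and Y: "invariant_extension y Y" and p: "p \<in> SU"
  shows "D X Y p = levi_civita_form x y ** p"
proof -
  define e where "e X Y x y = D X Y p ** dagger p - levi_civita_form x y" for X Y x y
  have e_su: "e X Y x y \<in> su" if "invariant_extension x X" "invariant_extension y Y" for X Y x y
  proof -
    have "D X Y p \<in> SU_tangent p"
      using D p invariant_extension_field[OF that(1)] invariant_extension_field[OF that(2)]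
      by (simp add: is_levi_civita_def affine_connection_def)
    then show ?thesis
      using that p by (simp add: e_def SU_tangent_iff su_closed levi_civita_form_su invariant_extension_def)
  qed
  have e_symmetric: "e X Y x y = e Y X y x"
    if "invariant_extension x X" "invariant_extension y Y" for X Y x y
  proof -
    have "D X Y p - D Y X p = - commutator x y ** p"
      using D p invariant_extension_field[OF that(1)] invariant_extension_field[OF that(2)]
        lie_bracket_invariant[OF that p] by (simp add: is_levi_civita_def)
    then have "(D X Y p - D Y X p) ** dagger p = - commutator x y" using p by simp
    then have "D X Y p ** dagger p - D Y X p ** dagger p = levi_civita_form x y - levi_civita_form y x"
      unfolding levi_civita_form_torsion_free mmul_diff_left .
    then show ?thesis by (simp add: e_def algebra_simps)
  qed
  have e_skew: "e X Y x y \<bullet> T z + y \<bullet> T (e X Z x z) = 0"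
    if "invariant_extension x X" "invariant_extension y Y" "invariant_extension z Z" for X Y Z x y z
  proof -
    have "metric q (Y q) (Z q) = y \<bullet> T z" if "q \<in> SU" for q
      using \<open>invariant_extension y Y\<close> \<open>invariant_extension z Z\<close> that
      by (simp add: metric_def invariant_extension_def)
    then have "SU_deriv (\<lambda>q. metric q (Y q) (Z q)) p (X p) = 0"
      using SU_frechet_derivative_cong[OF has_derivative_const _ p, of "\<lambda>q. metric q (Y q) (Z q)" "y \<bullet> T z"]
        invariant_extension_field[OF that(1)] p by (simp add: vector_field_def)
    moreover have "SU_deriv (\<lambda>q. metric q (Y q) (Z q)) p (X p)
       = metric p (D X Y p) (Z p) + metric p (Y p) (D X Z p)"
      using D p invariant_extension_field[OF that(1)] invariant_extension_field[OF that(2)]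
        invariant_extension_field[OF that(3)] by (simp add: is_levi_civita_def)
    moreover have "metric p (D X Y p) (Z p) = (D X Y p ** dagger p) \<bullet> T z"
      "metric p (Y p) (D X Z p) = y \<bullet> T (D X Z p ** dagger p)"
      using that p by (simp_all add: metric_def invariant_extension_def)
    moreover have "levi_civita_form x y \<bullet> T z + y \<bullet> T (levi_civita_form x z) = 0"
      using that by (intro levi_civita_form_metric) (simp_all add: invariant_extension_def)
    ultimately show ?thesis
      by (simp add: e_def inner_diff_left inner_diff_right T_simps)
  qed
  have flip: "a \<bullet> T b = b \<bullet> T a" for a b using T_symmetric[of a b] by (simp add: inner_commute)
  have "e X Y x y \<bullet> T z = 0" if "z \<in> su" for z
  proof -
    define Z where "Z = right_invariant_field z"
    have Z: "invariant_extension z Z" using that by (simp add: Z_def invariant_extension_right_invariant_field)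
    have "e X Y x y \<bullet> T z = - (y \<bullet> T (e Z X z x))"
      using e_skew[OF X Y Z] e_symmetric[OF X Z] by simp
    also have "\<dots> = x \<bullet> T (e Y Z y z)"
      using e_skew[OF Z X Y] e_symmetric[OF Z Y] flip[of y] by simp
    also have "\<dots> = - (e X Y x y \<bullet> T z)"
      using e_skew[OF Y Z X] e_symmetric[OF Y X] flip[of x] flip[of z] by simp
    finally show ?thesis by simp
  qed
  from this[OF e_su[OF X Y]] have "e X Y x y = 0" using T_positive[OF e_su[OF X Y]] by (cases "e X Y x y = 0") auto
  then have "D X Y p ** dagger p ** p = levi_civita_form x y ** p" by (simp add: e_def)
  then show ?thesis using p by simp
qed

definition curvature_form :: "complex^'n^'n \<Rightarrow> complex^'n^'n \<Rightarrow> complex^'n^'n \<Rightarrow> complex^'n^'n" where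
  "curvature_form x y z = levi_civita_form x (levi_civita_form y z)
    - levi_civita_form y (levi_civita_form x z) + levi_civita_form (commutator x y) z"

lemma riemann_curvature_invariant:
  assumes x: "x \<in> su" and y: "y \<in> su" and z: "z \<in> su"
  shows "riemann_curvature SU SU_tangent metric
    (right_invariant_field x) (right_invariant_field y) (right_invariant_field z) (mat 1) = curvature_form x y z"
proof -
  define D where "D = levi_civita SU SU_tangent metric"
  have D: "is_levi_civita SU SU_tangent metric D"
    unfolding D_def levi_civita_def by (rule someI[of "is_levi_civita SU SU_tangent metric", OF connection_levi_civita])
  note ext = invariant_extension_right_invariant_field
  let ?F = right_invariant_field
  have DD: "D (?F a) (D (?F b) (?F c)) (mat 1) = levi_civita_form a (levi_civita_form b c)"
    if "a \<in> su" "b \<in> su" "c \<in> su" for a b c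
  proof -
    have "invariant_extension (levi_civita_form b c) (D (?F b) (?F c))"
      using levi_civita_invariant[OF D ext[OF that(2)] ext[OF that(3)]] levi_civita_form_su[OF that(2,3)]
      by (simp add: invariant_extension_def)
    from levi_civita_invariant[OF D ext[OF that(1)] this one_SU] show ?thesis by simp
  qed
  have "invariant_extension (- commutator x y) (lie_bracket SU (?F x) (?F y))"
    using lie_bracket_invariant[OF ext[OF x] ext[OF y]] su_closed(3)[OF commutator_su[OF x y]]
    by (simp add: invariant_extension_def)
  from levi_civita_invariant[OF D this ext[OF z] one_SU]
  have "D (lie_bracket SU (?F x) (?F y)) (?F z) (mat 1) = - levi_civita_form (commutator x y) z"
    by (simp add: levi_civita_form_simps)
  then show ?thesis
    by (simp add: riemann_curvature_def Let_def D_def[symmetric] DD x y z curvature_form_def)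
qed

text \<open>
  When \<open>ad u\<close> commutes with \<open>T\<close>, the one-parameter group of \<open>u\<close> acts by isometries from either side
  and the form simplifies to \<open>\<nabla>\<^sub>x u = A x / 2\<close> and \<open>\<nabla>\<^sub>u x = A x / 2 - [u, x]\<close> with \<open>A x = T\<^sup>-\<^sup>1 [T u, x]\<close>. As \<open>u\<close>
  commutes with \<open>T u\<close>, the Jacobi identity makes \<open>A\<close> commute with \<open>ad u\<close>, and the terms linear in
  \<open>A\<close> cancel.
\<close>
lemma curvature_symmetric_direction:
  assumes u: "u \<in> su" and commute: "\<And>x. x \<in> su \<Longrightarrow> commutator u (T x) = T (commutator u x)"
    and y: "y \<in> su"
  shows "curvature_form y u u = - (1/4) *\<^sub>R inverse_inertia (commutator (T u) (inverse_inertia (commutator (T u) y)))"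
proof -
  define A where "A x = inverse_inertia (commutator (T u) x)" for x
  have A_su: "A x \<in> su" for x by (simp add: A_def inverse_inertia_su)
  have A_simps: "A (x + z) = A x + A z" "A (x - z) = A x - A z" "A (c *\<^sub>R x) = c *\<^sub>R A x" "A (- x) = - A x" for x z c
    by (simp_all add: A_def commutator_simps inverse_inertia_simps)
  have left: "levi_civita_form u x = (1/2) *\<^sub>R A x - commutator u x" if "x \<in> su" for x
  proof -
    have "inverse_inertia (commutator u (T x)) = commutator u x"
      using commute[OF that] inverse_inertia_T[OF commutator_su[OF u that]] by simp
    then have "levi_civita_form u x = - (1/2) *\<^sub>R (2 *\<^sub>R commutator u x - A x)"
      unfolding scaleR_2 by (simp add: levi_civita_form_def inverse_inertia_simps A_def)
    then show ?thesis by (simp add: scaleR_diff_right)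
  qed
  have right: "levi_civita_form x u = (1/2) *\<^sub>R A x" if "x \<in> su" for x
    using levi_civita_form_torsion_free[of u x] left[OF that] by (simp add: algebra_simps)
  have "commutator u (T u) = 0" using commute[OF u] by (simp add: commutator_simps T_simps)
  then have "commutator (T u) u = 0" using commutator_swap[of "T u" u] by simp
  then have Au: "A u = 0" by (simp add: A_def inverse_inertia_simps)
  have uA: "commutator u (A y) = A (commutator u y)"
  proof -
    have "T (commutator u (A y)) = commutator u (commutator (T u) y)"
      using commute[OF A_su[of y]] T_inverse_inertia[OF commutator_su[OF T_su[OF u] y]] by (simp add: A_def)
    also have "\<dots> = commutator (T u) (commutator u y)"
      using commutator_jacobi[of u "T u" y] \<open>commutator u (T u) = 0\<close> by (simp add: commutator_simps)
    finally have "inverse_inertia (T (commutator u (A y))) = A (commutator u y)" by (simp add: A_def)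
    then show ?thesis using inverse_inertia_T[OF commutator_su[OF u A_su]] by simp
  qed
  have "levi_civita_form u (levi_civita_form y u) = - (1/2) *\<^sub>R commutator u (A y) + (1/4) *\<^sub>R A (A y)"
    using left[OF A_su[of y]] by (simp add: right[OF y] levi_civita_form_simps scaleR_diff_right)
  moreover have "levi_civita_form (commutator y u) u = - (1/2) *\<^sub>R A (commutator u y)"
    by (simp add: commutator_swap[of y u] levi_civita_form_simps right[OF commutator_su[OF u y]])
  moreover have "levi_civita_form y (levi_civita_form u u) = 0" by (simp add: right[OF u] Au levi_civita_form_simps)
  ultimately show ?thesis by (simp add: curvature_form_def uA[unfolded A_def] A_def)
qed

text \<open>
  The operator \<open>A\<close> is skew for the metric because \<open>T (A x) = [T u, x]\<close> and \<open>ad (T u)\<close> is skew for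
  \<open>\<bullet>\<close>. So the trace of \<open>- A\<^sup>2 / 4\<close> is a sum of squares, positive as soon as \<open>A\<close> is not \<open>0\<close>.
\<close>
theorem ricci_positive_symmetric_direction:
  assumes u: "u \<in> su" and commute: "\<And>x. x \<in> su \<Longrightarrow> commutator u (T x) = T (commutator u x)"
    and w: "w \<in> su" "commutator (T u) w \<noteq> 0"
  shows "ricci SU SU_tangent metric right_invariant_field (mat 1) u u > 0"
proof -
  define A where "A x = inverse_inertia (commutator (T u) x)" for x
  define f where "f x = - (1/4) *\<^sub>R A (A x)" for x
  define k where "k x y = x \<bullet> T y" for x y
  have A_linear: "linear A" by (simp add: linear_iff A_def commutator_simps inverse_inertia_simps)
  have A_su: "A x \<in> su" for x by (simp add: A_def inverse_inertia_su)
  have f_linear: "linear f"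
    by (simp add: linear_iff f_def linear_add[OF A_linear] linear_scale[OF A_linear] scaleR_add_right)
  have k_linear: "linear (\<lambda>x. k x y)" for y by (simp add: linear_iff k_def inner_add_left)
  obtain E where E: "finite E" "E \<subseteq> su" "\<And>x. x \<in> su \<Longrightarrow> x = (\<Sum>e\<in>E. k x e *\<^sub>R e)"
  proof (rule orthonormal_basis_of_form[of su k])
    show "k x y = k y x" for x y using T_symmetric[of x y] by (simp add: k_def inner_commute)
  qed (use subspace_su k_linear T_positive in \<open>auto simp: k_def\<close>)
  have tangent: "SU_tangent (mat 1) = su" by (auto simp: SU_tangent_def)
  have "ricci SU SU_tangent metric right_invariant_field (mat 1) u u = (\<Sum>e\<in>E. k (f e) e)"
    unfolding ricci_def tangent
  proof (rule trace_on_orthonormal[where k = k, OF subspace_su k_linear f_linear _ _ E])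
    show "f x \<in> su" for x unfolding f_def by (intro su_closed A_su)
    show "riemann_curvature SU SU_tangent metric (right_invariant_field x) (right_invariant_field u)
        (right_invariant_field u) (mat 1) = f x" if "x \<in> su" for x
      using riemann_curvature_invariant[OF that u u] curvature_symmetric_direction[OF u commute that]
      by (simp add: f_def A_def)
  qed
  also have "\<dots> = (\<Sum>e\<in>E. (1/4) * (A e \<bullet> T (A e)))"
  proof (rule sum.cong)
    fix e assume "e \<in> E"
    then have e: "e \<in> su" using E(2) by blast
    have "k (f e) e = - (1/4) * (T (A (A e)) \<bullet> e)" by (simp add: k_def f_def T_symmetric)
    also have "T (A (A e)) = commutator (T u) (A e)"
      unfolding A_def[of "A e"] by (intro T_inverse_inertia commutator_su T_su u A_su)
    also have "commutator (T u) (A e) \<bullet> e = - (A e \<bullet> commutator (T u) e)"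
      by (intro inner_commutator_su T_su u)
    also have "commutator (T u) e = T (A e)"
      unfolding A_def by (intro T_inverse_inertia[symmetric] commutator_su T_su u e)
    finally show "k (f e) e = (1/4) * (A e \<bullet> T (A e))" by simp
  qed simp
  also have "\<dots> > 0"
  proof (rule ccontr)
    have nonneg: "0 \<le> (1/4) * (A e \<bullet> T (A e))" for e
      using T_positive[OF A_su[of e]] by (cases "A e = 0") (auto simp: less_imp_le)
    assume "\<not> ?thesis"
    moreover have "0 \<le> (\<Sum>e\<in>E. (1/4) * (A e \<bullet> T (A e)))" by (rule sum_nonneg[OF nonneg])
    ultimately have "(\<Sum>e\<in>E. (1/4) * (A e \<bullet> T (A e))) = 0" by linarith
    then have "\<forall>e\<in>E. (1/4) * (A e \<bullet> T (A e)) = 0"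
      by (subst (asm) sum_nonneg_eq_0_iff[OF E(1) nonneg])
    then have Ae: "A e = 0" if "e \<in> E" for e
      using T_positive[OF A_su[of e]] that by (cases "A e = 0") auto
    have "A w = (\<Sum>e\<in>E. k w e *\<^sub>R A e)"
      using arg_cong[OF E(3)[OF w(1)], of A] by (simp add: linear_sum[OF A_linear] linear_scale[OF A_linear])
    then have "A w = 0" using Ae by simp
    then have "commutator (T u) w = 0"
      using T_inverse_inertia[OF commutator_su[OF T_su[OF u] w(1)]] by (simp add: A_def T_simps)
    then show False using w(2) by contradiction
  qed
  finally show ?thesis .
qed

end

section \<open>Positivity of the Ricci curvature on the first eigenspace\<close>
theorem corollary1:
  fixes S1 S2 S3 :: "complex^'n^'n"
  assumes "CARD('n) \<ge> 2"
    and "so3_irrep S1 S2 S3"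
  shows "\<forall>u \<in> eigenspace_V S1 S2 S3 1. u \<noteq> 0 \<longrightarrow> zeitlin_ricci S1 S2 S3 u u > 0"
proof (intro ballI impI)
  fix u :: "complex^'n^'n"
  assume u: "u \<in> eigenspace_V S1 S2 S3 1" and "u \<noteq> 0"
  interpret so3_irreducible S1 S2 S3 using assms by unfold_locales
  define h where "h = hbar TYPE('n)"
  have "h > 0"
  proof -
    have "1 < (real CARD('n))\<^sup>2" using assms(1) by (simp add: one_less_power)
    then show ?thesis by (simp add: h_def hbar_def)
  qed
  define c where "c = h\<^sup>2 / real CARD('n)"
  have "c > 0" using \<open>h > 0\<close> by (simp add: c_def)
  define T where "T x = - c *\<^sub>R laplacian S1 S2 S3 x" for x
  interpret right_invariant_metric T
  proof (rule right_invariant_metric.intro)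
    show "linear T" by (simp add: linear_iff T_def laplacian_linear scaleR_add_right)
    show "T x \<in> su" if "x \<in> su" for x
      using that unfolding T_def by (intro subspace_scale[OF subspace_su] laplacian_su)
    show "T x \<bullet> y = x \<bullet> T y" for x y by (simp add: T_def laplacian_symmetric)
    show "x \<bullet> T x > 0" if "x \<in> su" "x \<noteq> 0" for x
      using laplacian_negative_definite[OF that] \<open>c > 0\<close> by (simp add: T_def mult_pos_neg)
  qed
  have metric: "zeitlin_metric S1 S2 S3 = metric"
    by (simp add: fun_eq_iff zeitlin_metric_def zeitlin_inner_def metric_def T_def laplacian_linear
        c_def power2_eq_square inner_matrix_trace flip: h_def)
  have u_su: "u \<in> su" and lap_u: "laplacian S1 S2 S3 u = - 2 *\<^sub>R u"
    using u by (simp_all add: eigenspace_V_def)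
  let ?v = "(1 / h) *\<^sub>R u"
  have commute: "commutator ?v (T x) = T (commutator ?v x)" for x
    using laplacian_commutator_eigenspace_V_1[OF u, of x]
    by (simp add: T_def commutator_simps laplacian_linear)
  obtain w where w: "w \<in> su" "commutator u w \<noteq> 0"
    using su_center_trivial[OF u_su] \<open>u \<noteq> 0\<close> by blast
  have "T ?v = (2 * c / h) *\<^sub>R u" by (simp add: T_def laplacian_linear lap_u)
  then have "commutator (T ?v) w \<noteq> 0"
    using w(2) \<open>c > 0\<close> \<open>h > 0\<close> by (simp add: commutator_simps)
  with ricci_positive_symmetric_direction[OF subspace_scale[OF subspace_su u_su] commute w(1)]
  show "zeitlin_ricci S1 S2 S3 u u > 0"
    by (simp add: zeitlin_ricci_def metric h_def)
qed

end
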